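(* Let $G$ be a connected graph with at least two vertices. Then $\lambda_2(G)\in(-\infty,-0.5858)$ if and only if one of the following holds: $G\cong K_n$ for some $n\ge 2$; or $G\cong K_1\vee(K_{n_1}\cup K_{n_2})$ for some $n_1,n_2\ge 1$; or $G\cong K_1\vee(K_{n_1}\cup K_{n_2}\cup K_{n_3})$ for some $n_1,n_2,n_3\ge 1$; or $G\cong K_1\vee(K_{n_1}\cup K_{n_2}\cup K_{n_3}\cup K_{n_4})$ for some integers $n_1,n_2,n_3,n_4$ with $1\le n_1\le n_2\le n_3\le n_4$ such that one of the following items holds: (i) $n_1=n_2=1$ and $1\le n_3\le 873$; (ii) $n_1=n_2=1$, $n_3\ge 874$, and $r(-0.5858)<0$, where $r(\lambda)=\lambda^4-(n_3+n_4)\lambda^3-(3n_3n_4+8n_3+8n_4+5)\lambda^2-(12n_3n_4+11n_3+11n_4+6)\lambda-(6n_3n_4+4n_3+4n_4+2)$; (iii) $n_1=1$, $n_2=2$, and either $n_3=2$, or $3=n_3\le n_4\le 870$, or $4=n_3\le n_4\le 14$, or $5=n_3\le n_4\le 8$, or $n_3=n_4=6$; (iv) $n_1=1$, $n_2=3$, and either $3=n_3\le n_4\le 7$ or $n_3=n_4=4$; (v) $n_1=n_2=n_3=2$ and $2\le n_4\le 5$.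
   Context: All graphs are finite, simple and undirected. For a connected graph $G$ with vertices $v_1,\dots,v_n$, the distance matrix $D(G)$ is the $n\times n$ matrix whose $(i,j)$ entry is the distance (length of a shortest path) between $v_i$ and $v_j$ in $G$. The distance eigenvalues $\lambda_1(G)\ge\lambda_2(G)\ge\dots\ge\lambda_n(G)$ are the eigenvalues of $D(G)$ in non-increasing order; $\lambda_2(G)$ is the second largest. $K_m$ denotes the complete graph on $m$ vertices. For vertex-disjoint graphs $G_1,G_2$, $G_1\cup G_2$ is their disjoint union, and $G_1\vee G_2$ is the join, obtained from $G_1\cup G_2$ by adding all edges between a vertex of $G_1$ and a vertex of $G_2$. *)

theory Defs
  imports
    "Graph_Theory.Graph_Theory"
    "Jordan_Normal_Form.Char_Poly"
    "HOL-Library.Multiset"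
begin

text \<open>
  Simple undirected graphs are modelled as in the Graph Theory entry: a vertex set together
  with a symmetric, irreflexive set of ordered pairs (locale \<^locale>\<open>pair_graph\<close>, which also
  requires finiteness).
\<close>

definition graph_dist :: "'a pair_pre_digraph \<Rightarrow> 'a \<Rightarrow> 'a \<Rightarrow> nat" where
  "graph_dist G u v = (LEAST k. \<exists>p. pre_digraph.apath (with_proj G) u p v \<and> length p = k)"

text \<open>
  The list \<open>vs\<close> is the numbering of the vertices; it is meant to enumerate \<open>pverts G\<close>
  without repetition.
\<close>

definition distance_matrix :: "'a pair_pre_digraph \<Rightarrow> 'a list \<Rightarrow> real mat" where
  "distance_matrix G vs =
     mat (length vs) (length vs) (\<lambda>(i, j). real (graph_dist G (vs ! i) (vs ! j)))"

text \<open>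
  The distance eigenvalues, repeated according to multiplicity, in non-increasing order.  As the
  distance matrix is real symmetric, all roots of its characteristic polynomial are real, so for
  an enumeration \<open>vs\<close> of the vertices this list has length \<open>length vs\<close>.
\<close>

definition distance_eigenvalues :: "'a pair_pre_digraph \<Rightarrow> 'a list \<Rightarrow> real list" where
  "distance_eigenvalues G vs =
     rev (sorted_list_of_multiset (proots (char_poly (distance_matrix G vs))))"

text \<open>The index starts at 1, so that \<open>distance_eigenvalue G vs 1\<close> is the largest one.\<close>

definition distance_eigenvalue :: "'a pair_pre_digraph \<Rightarrow> 'a list \<Rightarrow> nat \<Rightarrow> real" where
  "distance_eigenvalue G vs i = distance_eigenvalues G vs ! (i - 1)"

definition complete_graph :: "nat \<Rightarrow> nat pair_pre_digraph" where
  "complete_graph m = \<lparr> pverts = {..<m}, parcs = {(u, v). u < m \<and> v < m \<and> u \<noteq> v} \<rparr>"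

lemma complete_digraph_complete_graph: "complete_digraph m (with_proj (complete_graph m))"
  by (auto simp: complete_digraph_pair_def complete_graph_def)

text \<open>Union and join make their operands vertex-disjoint by using a sum type.\<close>

definition disjoint_union ::
    "'a pair_pre_digraph \<Rightarrow> 'b pair_pre_digraph \<Rightarrow> ('a + 'b) pair_pre_digraph"
    (infixr \<open>\<union>\<^sub>g\<close> 65) where
  "G \<union>\<^sub>g H = \<lparr> pverts = pverts G <+> pverts H,
     parcs = map_prod Inl Inl ` parcs G \<union> map_prod Inr Inr ` parcs H \<rparr>"

definition join ::
    "'a pair_pre_digraph \<Rightarrow> 'b pair_pre_digraph \<Rightarrow> ('a + 'b) pair_pre_digraph"
    (infixr \<open>\<or>\<^sub>g\<close> 64) where
  "G \<or>\<^sub>g H = \<lparr> pverts = pverts (G \<union>\<^sub>g H),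
     parcs = parcs (G \<union>\<^sub>g H) \<union> Inl ` pverts G \<times> Inr ` pverts H
       \<union> Inr ` pverts H \<times> Inl ` pverts G \<rparr>"

abbreviation graph_iso ::
    "'a pair_pre_digraph \<Rightarrow> 'b pair_pre_digraph \<Rightarrow> bool" (infix \<open>\<cong>\<^sub>g\<close> 50) where
  "G \<cong>\<^sub>g H \<equiv> digraph_iso (with_proj G) (with_proj H)"

definition r_poly :: "nat \<Rightarrow> nat \<Rightarrow> real \<Rightarrow> real" where
  "r_poly n\<^sub>3 n\<^sub>4 x = x ^ 4 - (n\<^sub>3 + n\<^sub>4) * x ^ 3
     - (3 * n\<^sub>3 * n\<^sub>4 + 8 * n\<^sub>3 + 8 * n\<^sub>4 + 5) * x ^ 2
     - (12 * n\<^sub>3 * n\<^sub>4 + 11 * n\<^sub>3 + 11 * n\<^sub>4 + 6) * x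
     - (6 * n\<^sub>3 * n\<^sub>4 + 4 * n\<^sub>3 + 4 * n\<^sub>4 + 2)"

end

theory Submission
  imports
    Defs
    "Jordan_Normal_Form.Spectral_Radius"
    "HOL-Analysis.Convex"
    "HOL-Combinatorics.Permutations"
begin

text \<open>
  Put \<open>a = 0.5858\<close> and \<open>q f = (\<Sum>u v. dist u v * f u * f v) + a * (\<Sum>u. (f u)\<^sup>2)\<close>.  By the spectral
  theorem the second largest distance eigenvalue is below \<open>- a\<close> iff \<open>q\<close> is nonnegative on no
  plane.  Restricting \<open>q\<close> to four vertices produces such a plane for an isometric path \<open>P\<^sub>4\<close> (its
  second eigenvalue \<open>-2 + \<surd>2\<close> is barely above \<open>- a\<close>), so the diameter is at most 2, and then for
  an induced \<open>P\<^sub>4\<close>, \<open>C\<^sub>4\<close> or diamond; a connected graph without these is a vertex \<open>c\<close> joined to a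
  disjoint union of cliques.

  For such a cone over cliques of orders \<open>n\<^sub>i\<close>, let \<open>s\<^sub>i\<close> be the sum of \<open>f\<close> over the \<open>i\<close>-th clique
  and \<open>S = (\<Sum>i. s\<^sub>i)\<close>.  For \<open>f\<close> constant on each clique, completing the square in \<open>f c\<close> gives
  \<open>q f = a * (f c + S / a)\<^sup>2 + (2 - 1 / a) * S\<^sup>2 - (\<Sum>i. b\<^sub>i * s\<^sub>i\<^sup>2)\<close> with
  \<open>b\<^sub>i = 1 + (1 - a) / n\<^sub>i\<close>, and other \<open>f\<close> only have smaller \<open>q f\<close>.  By Cauchy--Schwarz the
  eigenvalue condition becomes
  \<open>(\<Sum>i. n\<^sub>i / (n\<^sub>i + (1 - a))) < a / (2 * a - 1) = 2929 / 858\<close>, which always holds for at most three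
  cliques, never for more than four, and for four cliques amounts to the given table.
\<close>

subsection \<open>Orthogonal diagonalization of real symmetric matrices\<close>

text \<open>A complex eigenvector \<open>w\<close> exists because the spectrum over the complex
  numbers is nonempty. Symmetry makes its eigenvalue real, so the real and imaginary parts of
  \<open>w\<close> satisfy the same eigenvector equation, and one of them is nonzero.\<close>

lemma symmetric_real_eigenvector:
  fixes A :: "real mat"
  assumes A: "A \<in> carrier_mat n n" and sym: "A\<^sup>T = A" and n: "n \<noteq> 0"
  obtains v e where "v \<in> carrier_vec n" "v \<noteq> 0\<^sub>v n" "A *\<^sub>v v = e \<cdot>\<^sub>v v"
proof -
  define C where "C = map_mat complex_of_real A"
  have C: "C \<in> carrier_mat n n" using A by (simp add: C_def)
  have Aij: "A $$ (i, j) = A $$ (j, i)" if "i < n" "j < n" for i j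
    using that A sym by (metis carrier_matD index_transpose_mat(1))
  obtain z where "z \<in> spectrum C"
    using spectrum_non_empty[OF C] n by auto
  then obtain w where w: "w \<in> carrier_vec n" "w \<noteq> 0\<^sub>v n" "C *\<^sub>v w = z \<cdot>\<^sub>v w"
    using C by (auto simp: spectrum_def eigenvalue_def eigenvector_def)
  have row: "(\<Sum>j<n. complex_of_real (A $$ (i, j)) * w $ j) = z * w $ i" if "i < n" for i
  proof -
    have "(C *\<^sub>v w) $ i = z * w $ i" using that w by simp
    then show ?thesis
      using that A w(1) by (simp add: C_def scalar_prod_def atLeast0LessThan)
  qed
  have row_sum: "(\<Sum>i<n. \<Sum>j<n. complex_of_real (A $$ (i, j)) * w $ j * cnj (w $ i))
      = z * of_real (\<Sum>i<n. (cmod (w $ i))\<^sup>2)"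
  proof -
    have "(\<Sum>i<n. \<Sum>j<n. complex_of_real (A $$ (i, j)) * w $ j * cnj (w $ i))
      = (\<Sum>i<n. z * w $ i * cnj (w $ i))"
      by (rule sum.cong) (simp_all add: row flip: sum_distrib_right)
    also have "\<dots> = z * of_real (\<Sum>i<n. (cmod (w $ i))\<^sup>2)"
      by (simp add: sum_distrib_left complex_norm_square mult.assoc del: of_real_power)
    finally show ?thesis .
  qed
  \<comment> \<open>The Hermitian form of a real symmetric matrix takes real values: conjugation
    only exchanges the two summation indices.\<close>
  have "cnj (\<Sum>i<n. \<Sum>j<n. complex_of_real (A $$ (i, j)) * w $ j * cnj (w $ i))
     = (\<Sum>i<n. \<Sum>j<n. complex_of_real (A $$ (i, j)) * w $ j * cnj (w $ i))"
    by (subst (2) sum.swap) (auto simp: Aij mult_ac intro!: sum.cong)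
  then have zz: "cnj z * of_real (\<Sum>i<n. (cmod (w $ i))\<^sup>2) = z * of_real (\<Sum>i<n. (cmod (w $ i))\<^sup>2)"
    unfolding row_sum by simp
  obtain i0 where i0: "i0 < n" "w $ i0 \<noteq> 0"
    using w(1,2) by (metis carrier_vecD eq_vecI index_zero_vec(1) index_zero_vec(2))
  have "(\<Sum>i<n. (cmod (w $ i))\<^sup>2) \<noteq> 0"
    using i0 by (subst sum_nonneg_eq_0_iff) auto
  with zz have "cnj z = z" by (simp del: of_real_sum of_real_power)
  then have z: "z = of_real (Re z)"
    by (metis Reals_cnj_iff of_real_Re)
  \<comment> \<open>Whichever part of \<open>w\<close> is chosen, it is nonzero at
    \<open>i0\<close>.\<close>
  define v where "v = (if Re (w $ i0) \<noteq> 0 then vec n (\<lambda>i. Re (w $ i)) else vec n (\<lambda>i. Im (w $ i)))"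
  have "v $ i0 \<noteq> 0" using i0 by (auto simp: v_def complex_eq_iff)
  then have "v \<noteq> 0\<^sub>v n" using i0 by auto
  moreover have "v \<in> carrier_vec n" by (simp add: v_def)
  moreover have "A *\<^sub>v v = Re z \<cdot>\<^sub>v v"
  proof (rule eq_vecI)
    fix i assume "i < dim_vec (Re z \<cdot>\<^sub>v v)"
    then have i: "i < n" by (simp add: v_def split: if_splits)
    have "Re (\<Sum>j<n. complex_of_real (A $$ (i, j)) * w $ j) = Re z * Re (w $ i)"
         "Im (\<Sum>j<n. complex_of_real (A $$ (i, j)) * w $ j) = Re z * Im (w $ i)"
      unfolding row[OF i] by (subst z; simp)+
    then show "(A *\<^sub>v v) $ i = (Re z \<cdot>\<^sub>v v) $ i"
      using i A by (auto simp: v_def scalar_prod_def atLeast0LessThan)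
  qed (use A in \<open>auto simp: v_def\<close>)
  ultimately show thesis using that by blast
qed

text \<open>The reflection swapping the unit vectors \<open>v\<close> and \<open>unit_vec n 0\<close>; the sign of \<open>v\<close> is
  chosen so that they differ.\<close>

lemma householder:
  fixes v :: "nat \<Rightarrow> real"
  assumes n: "0 < n" and unit: "(\<Sum>i<n. (v i)\<^sup>2) = 1" and v0: "v 0 \<le> 0"
  obtains W where "W \<in> carrier_mat n n" "W\<^sup>T = W" "W * W = 1\<^sub>m n" "col W 0 = vec n v"
proof -
  \<comment> \<open>\<open>W\<close> is the reflection \<open>1 - c * u * u\<^sup>T\<close> along
    the difference \<open>u\<close> of the unit vector at 0 and \<open>v\<close>. As
    \<open>v\<close> has norm 1, the squared norm of \<open>u\<close> is
    \<open>2 * (1 - v 0)\<close>, and \<open>c\<close> is 2 divided by it;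
    \<open>v 0 \<le> 0\<close> keeps \<open>1 - v 0\<close> positive.\<close>
  define u where "u i = (if i = 0 then 1 else 0) - v i" for i
  define c where "c = 1 / (1 - v 0)"
  define W where "W = mat n n (\<lambda>(i, j). (if i = j then 1 else 0) - c * u i * u j)"
  have "(\<Sum>i<n. (u i)\<^sup>2) = (\<Sum>i<n. (v i)\<^sup>2 + (if i = 0 then 1 - 2 * v 0 else 0))"
    by (rule sum.cong) (auto simp: u_def power2_eq_square algebra_simps)
  then have uu: "c * (\<Sum>i<n. (u i)\<^sup>2) = 2"
    using n v0 by (simp add: sum.distrib unit c_def field_simps)
  have [simp]: "W \<in> carrier_mat n n" by (simp add: W_def)
  have "W * W = 1\<^sub>m n"
  proof (rule eq_matI)
    fix i j assume "i < dim_row (1\<^sub>m n)" "j < dim_col (1\<^sub>m n)"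
    then have ij: "i < n" "j < n" by auto
    have "(W * W) $$ (i, j) = (\<Sum>k<n. ((if i = k then 1 else 0) - c * u i * u k)
        * ((if k = j then 1 else 0) - c * u k * u j))"
      using ij by (simp add: W_def scalar_prod_def atLeast0LessThan)
    also have "\<dots> = (\<Sum>k<n. (if k = i then (if i = j then 1 else 0) - c * u i * u j else 0)
        - (if k = j then c * u i * u j else 0) + c * u i * u j * (c * (u k)\<^sup>2))"
      by (rule sum.cong) (auto simp: power2_eq_square algebra_simps)
    also have "\<dots> = ((if i = j then 1 else 0) - c * u i * u j) - c * u i * u j
        + c * u i * u j * (c * (\<Sum>k<n. (u k)\<^sup>2))"
      using ij by (simp add: sum.distrib sum_subtractf flip: sum_distrib_left)
    also have "\<dots> = 1\<^sub>m n $$ (i, j)"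
      unfolding uu using ij by simp
    finally show "(W * W) $$ (i, j) = 1\<^sub>m n $$ (i, j)" .
  qed (simp_all add: W_def)
  moreover have "W\<^sup>T = W" by (auto simp: W_def)
  moreover have "col W 0 = vec n v"
    using n v0 by (auto simp: W_def u_def c_def)
  ultimately show thesis using that \<open>W \<in> _\<close> by blast
qed

text \<open>Induction on the dimension. Conjugation with a reflection \<open>W\<close> whose first
  column is a unit eigenvector splits off a 1 by 1 block; the remaining block is again symmetric and
  is diagonalized by an orthogonal \<open>Q\<close>. Then \<open>P\<close> is \<open>W\<close> times
  the block matrix of 1 and \<open>Q\<close>.\<close>

theorem symmetric_real_diagonalizable:
  fixes A :: "real mat"
  assumes "A \<in> carrier_mat n n" and "A\<^sup>T = A"
  shows "\<exists>P. P \<in> carrier_mat n n \<and> P\<^sup>T * P = 1\<^sub>m n \<and> diagonal_mat (P\<^sup>T * A * P)"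
  using assms
proof (induction n arbitrary: A)
  case 0
  then show ?case by (intro exI[of _ "1\<^sub>m 0"]) (auto simp: diagonal_mat_def)
next
  case (Suc m A)
  note A = Suc.prems(1)
  obtain v e where v: "v \<in> carrier_vec (Suc m)" "v \<noteq> 0\<^sub>v (Suc m)" "A *\<^sub>v v = e \<cdot>\<^sub>v v"
    using symmetric_real_eigenvector[OF Suc.prems] by blast
  \<comment> \<open>\<open>r\<close> scales \<open>v\<close> to norm 1 and makes its entry at index
    0 nonpositive, as \<open>householder\<close> requires.\<close>
  define r where "r = (if v $ 0 \<le> 0 then 1 else - 1) / sqrt (\<Sum>i<Suc m. (v $ i)\<^sup>2)"
  obtain i0 where i0: "i0 < Suc m" "v $ i0 \<noteq> 0"
    using v(1,2) by (metis carrier_vecD eq_vecI index_zero_vec(1) index_zero_vec(2))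
  have pos: "(\<Sum>i<Suc m. (v $ i)\<^sup>2) > 0"
    by (rule sum_pos2[of _ i0]) (use i0 in auto)
  have "r\<^sup>2 * (\<Sum>i<Suc m. (v $ i)\<^sup>2) = 1"
    using pos by (simp add: r_def power_divide del: sum.lessThan_Suc)
  then have unit: "(\<Sum>i<Suc m. (r * v $ i)\<^sup>2) = 1"
    by (simp only: power_mult_distrib flip: sum_distrib_left)
  have "r * v $ 0 \<le> 0"
    using pos by (auto simp: r_def divide_simps mult_le_0_iff simp del: sum.lessThan_Suc)
  then obtain W where W: "W \<in> carrier_mat (Suc m) (Suc m)" "W\<^sup>T = W" "W * W = 1\<^sub>m (Suc m)"
    and col: "col W 0 = vec (Suc m) (\<lambda>i. r * v $ i)"
    using householder[OF _ unit] by auto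
  have colv: "col W 0 = r \<cdot>\<^sub>v v" using v(1) unfolding col by auto
  define B where "B = W * A * W"
  have B: "B \<in> carrier_mat (Suc m) (Suc m)" using A W by (simp add: B_def)
  have Bt: "B\<^sup>T = B"
    using A W Suc.prems(2) unfolding B_def
    by (simp add: transpose_mult[of _ "Suc m" "Suc m" _ "Suc m"] assoc_mult_mat[of _ "Suc m" "Suc m" _ "Suc m" _ "Suc m"])
  have AW: "A * W \<in> carrier_mat (Suc m) (Suc m)" using A W by simp
  \<comment> \<open>\<open>W\<close> sends the unit vector at 0 to a multiple of \<open>v\<close>,
    \<open>A\<close> multiplies that by \<open>e\<close>, and \<open>W\<close> sends it back because
    \<open>W * W\<close> is the identity. By symmetry of \<open>B\<close> this settles its first row
    too.\<close>
  have "col B 0 = col (W * (A * W)) 0"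
    by (simp add: B_def assoc_mult_mat[OF W(1) A W(1)])
  also have "\<dots> = W *\<^sub>v col (A * W) 0" by (rule col_mult2[OF W(1) AW]) simp
  also have "col (A * W) 0 = A *\<^sub>v col W 0" by (rule col_mult2[OF A W(1)]) simp
  also have "W *\<^sub>v (A *\<^sub>v col W 0) = e \<cdot>\<^sub>v (W *\<^sub>v col W 0)"
    using A W v by (simp add: colv mult_mat_vec[of _ "Suc m" "Suc m"] smult_smult_assoc mult.commute)
  also have "W *\<^sub>v col W 0 = col (W * W) 0" by (rule col_mult2[OF W(1) W(1), symmetric]) simp
  also have "\<dots> = unit_vec (Suc m) 0" unfolding W(3) by simp
  finally have B0: "col B 0 = e \<cdot>\<^sub>v unit_vec (Suc m) 0" .
  define C where "C = mat m m (\<lambda>(i, j). B $$ (Suc i, Suc j))"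
  have C: "C \<in> carrier_mat m m" by (simp add: C_def)
  have Bij: "B $$ (i, j) = B $$ (j, i)" if "i < Suc m" "j < Suc m" for i j
    using that B Bt by (metis carrier_matD index_transpose_mat(1))
  have Bi0: "B $$ (i, 0) = (if i = 0 then e else 0)" if "i < Suc m" for i
  proof -
    have "B $$ (i, 0) = col B 0 $ i" using that B by simp
    then show ?thesis using that unfolding B0 by simp
  qed
  have "C\<^sup>T = C" by (rule eq_matI) (auto simp: C_def intro!: Bij)
  from Suc.IH[OF C this] obtain Q where Q: "Q \<in> carrier_mat m m" "Q\<^sup>T * Q = 1\<^sub>m m"
    "diagonal_mat (Q\<^sup>T * C * Q)" by blast
  define E where "E = mat 1 1 (\<lambda>_. e)"
  have E: "E \<in> carrier_mat 1 1" by (simp add: E_def)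
  have Bblock: "B = four_block_mat E (0\<^sub>m 1 m) (0\<^sub>m m 1) C"
  proof (rule eq_matI)
    fix i j
    assume "i < dim_row (four_block_mat E (0\<^sub>m 1 m) (0\<^sub>m m 1) C)"
      "j < dim_col (four_block_mat E (0\<^sub>m 1 m) (0\<^sub>m m 1) C)"
    then have ij: "i < Suc m" "j < Suc m" by (auto simp: E_def C_def)
    then show "B $$ (i, j) = four_block_mat E (0\<^sub>m 1 m) (0\<^sub>m m 1) C $$ (i, j)"
      using Bi0[of i] Bi0[of j] Bij[of 0 j] by (auto simp: E_def C_def)
  qed (use B in \<open>auto simp: E_def C_def\<close>)
  define R where "R = four_block_mat (1\<^sub>m 1) (0\<^sub>m 1 m) (0\<^sub>m m 1) Q"
  have R: "R \<in> carrier_mat (Suc m) (Suc m)"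
    using four_block_carrier_mat[of "1\<^sub>m 1" 1 1 Q m m "0\<^sub>m 1 m" "0\<^sub>m m 1"] Q by (simp add: R_def)
  have Rt: "R\<^sup>T = four_block_mat (1\<^sub>m 1) (0\<^sub>m 1 m) (0\<^sub>m m 1) Q\<^sup>T"
    using Q unfolding R_def by (subst transpose_four_block_mat) auto
  have RR: "R\<^sup>T * R = 1\<^sub>m (Suc m)"
    unfolding Rt unfolding R_def using Q
    by (subst mult_four_block_mat[of _ 1 1 _ m _ m _ _ 1 _ m])
      (auto simp: four_block_one_mat[of 1 m, simplified])
  have RBR: "R\<^sup>T * B * R = four_block_mat E (0\<^sub>m 1 m) (0\<^sub>m m 1) (Q\<^sup>T * C * Q)"
    unfolding Rt unfolding R_def Bblock using Q C E
    by (subst mult_four_block_mat[of _ 1 1 _ m _ m _ _ 1 _ m], simp_all)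
       (subst mult_four_block_mat[of _ 1 1 _ m _ m _ _ 1 _ m], simp_all)
  have "diagonal_mat (R\<^sup>T * B * R)"
    unfolding RBR using Q C by (auto simp: diagonal_mat_def E_def)
  moreover have "(W * R)\<^sup>T = R\<^sup>T * W" using W R by (simp add: transpose_mult)
  moreover have "R\<^sup>T * W * A * (W * R) = R\<^sup>T * B * R"
    unfolding B_def using W R A
    by (simp add: assoc_mult_mat[of _ "Suc m" "Suc m" _ "Suc m" _ "Suc m"])
  moreover have "R\<^sup>T * W * (W * R) = R\<^sup>T * (W * W) * R"
    using W(1) R by (simp add: assoc_mult_mat[of _ "Suc m" "Suc m" _ "Suc m" _ "Suc m"])
  ultimately show ?case using W R RR by (intro exI[of _ "W * R"]) auto
qed

subsection \<open>The second largest eigenvalue\<close>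

text \<open>The second entry of a non-increasing list is below \<open>c\<close> iff at most one
  entry is \<ge> \<open>c\<close>, and this count survives sorting. The right-hand side speaks of
  positions, not of values, so that repeated eigenvalues count with multiplicity.\<close>

lemma sorted_list_nth_1_less_iff:
  fixes es :: "real list"
  assumes "length es \<ge> 2"
  shows "rev (sort es) ! 1 < c \<longleftrightarrow>
    (\<forall>i<length es. \<forall>j<length es. c \<le> es ! i \<longrightarrow> c \<le> es ! j \<longrightarrow> i = j)"
proof -
  define L where "L = rev (sort es)"
  have len: "length L = length es" by (simp add: L_def)
  have L01: "L ! 1 \<le> L ! 0" and L1: "\<And>k. 1 \<le> k \<Longrightarrow> k < length L \<Longrightarrow> L ! k \<le> L ! 1"
    using assms len by (auto intro!: sorted_rev_nth_mono simp: L_def)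
  have filt: "length (filter (\<lambda>x. c \<le> x) L) = length (filter (\<lambda>x. c \<le> x) es)"
    by (simp add: L_def filter_sort flip: rev_filter)
  have card_eq: "length (filter (\<lambda>x. c \<le> x) xs) = card {i. i < length xs \<and> c \<le> xs ! i}" for xs :: "real list"
    by (rule length_filter_conv_card)
  have "L ! 1 < c \<longleftrightarrow> card {i. i < length L \<and> c \<le> L ! i} \<le> 1"
  proof
    assume "L ! 1 < c"
    then have "{i. i < length L \<and> c \<le> L ! i} \<subseteq> {0}"
      using L1 by (force simp: not_less_eq_eq)
    then show "card {i. i < length L \<and> c \<le> L ! i} \<le> 1"
      using card_mono[of "{0::nat}"] by auto
  next
    assume *: "card {i. i < length L \<and> c \<le> L ! i} \<le> 1"
    show "L ! 1 < c"
    proof (rule ccontr)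
      assume "\<not> L ! 1 < c"
      then have "{0, 1} \<subseteq> {i. i < length L \<and> c \<le> L ! i}"
        using L01 assms len by auto
      from card_mono[OF _ this] * show False by simp
    qed
  qed
  also have "\<dots> \<longleftrightarrow> card {i. i < length es \<and> c \<le> es ! i} \<le> 1"
    using filt by (simp add: card_eq)
  also have "\<dots> \<longleftrightarrow> (\<forall>i<length es. \<forall>j<length es. c \<le> es ! i \<longrightarrow> c \<le> es ! j \<longrightarrow> i = j)"
    by (subst card_le_Suc0_iff_eq[unfolded One_nat_def[symmetric]]) auto
  finally show ?thesis unfolding L_def .
qed

lemma proots_prod_linear: "proots (\<Prod>e\<leftarrow>es. [:- e, 1:]) = mset es"
proof -
  have "proots (\<Prod>e\<leftarrow>es. [:- e, 1:]) = (\<Sum>p\<leftarrow>map (\<lambda>e. [:- e, 1:]) es. proots p)"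
    using proots_prod_list[of "map (\<lambda>e. [:- e, 1:]) es"] by (simp add: image_iff)
  also have "\<dots> = mset es" by (induction es) auto
  finally show ?thesis .
qed

section \<open>Planes on which the shifted quadratic form is nonnegative\<close>

definition shifted_form :: "'a set \<Rightarrow> ('a \<Rightarrow> 'a \<Rightarrow> real) \<Rightarrow> real \<Rightarrow> ('a \<Rightarrow> real) \<Rightarrow> real" where
  "shifted_form V d a f = (\<Sum>u\<in>V. \<Sum>v\<in>V. d u v * f u * f v) + a * (\<Sum>u\<in>V. (f u)\<^sup>2)"

text \<open>\<open>f\<close> and \<open>g\<close> form a basis of the plane. Functions are total
  while vectors live on \<open>V\<close>, hence linear independence is tested on
  \<open>V\<close>.\<close>

definition nonneg_plane :: "'a set \<Rightarrow> ('a \<Rightarrow> 'a \<Rightarrow> real) \<Rightarrow> real \<Rightarrow> bool" where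
  "nonneg_plane V d a \<longleftrightarrow> (\<exists>f g.
     (\<forall>s t. (\<forall>u\<in>V. s * f u + t * g u = 0) \<longrightarrow> s = 0 \<and> t = 0) \<and>
     (\<forall>s t. 0 \<le> shifted_form V d a (\<lambda>u. s * f u + t * g u)))"

text \<open>A Courant-Fischer argument. In eigenvector coordinates the form is a sum of squares with
  coefficients \<open>es ! i + a\<close>. If at most one of these is nonnegative, every plane
  contains a nonzero vector whose coordinate there vanishes, and the form is negative at it; if two
  are nonnegative, their eigenvectors span a plane as required.\<close>

theorem second_eigenvalue_less_iff:
  fixes d :: "'a \<Rightarrow> 'a \<Rightarrow> real"
  assumes vs: "distinct vs" "length vs \<ge> 2"
    and sym: "\<And>u v. u \<in> set vs \<Longrightarrow> v \<in> set vs \<Longrightarrow> d u v = d v u"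
  defines "A \<equiv> mat (length vs) (length vs) (\<lambda>(i, j). d (vs ! i) (vs ! j))"
  shows "rev (sorted_list_of_multiset (proots (char_poly A))) ! 1 < - a \<longleftrightarrow>
    \<not> nonneg_plane (set vs) d a"
proof -
  define n where "n = length vs"
  have A: "A \<in> carrier_mat n n" by (simp add: A_def n_def)
  have At: "A\<^sup>T = A" by (rule eq_matI) (auto simp: A_def intro: sym)
  obtain P where P: "P \<in> carrier_mat n n" "P\<^sup>T * P = 1\<^sub>m n" and diag: "diagonal_mat (P\<^sup>T * A * P)"
    using symmetric_real_diagonalizable[OF A At] by blast
  have PP: "P * P\<^sup>T = 1\<^sub>m n"
    using mat_mult_left_right_inverse[of "P\<^sup>T" n P] P by simp
  define D where "D = P\<^sup>T * A * P"
  have D: "D \<in> carrier_mat n n" using A P by (simp add: D_def)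
  define es where "es = diag_mat D"
  have len: "length es = n" using D by (simp add: es_def diag_mat_def)
  have "similar_mat D A"
    unfolding similar_mat_def
    by (intro exI[of _ "P\<^sup>T"] exI[of _ P] similar_mat_witI[of _ _ n]) (use A P PP D in \<open>auto simp: D_def\<close>)
  then have "char_poly A = char_poly D" by (simp add: char_poly_similar)
  also have "\<dots> = (\<Prod>e\<leftarrow>es. [:- e, 1:])"
    unfolding es_def
    by (rule char_poly_upper_triangular[OF D]) (use diag D in \<open>auto simp: D_def diagonal_mat_def upper_triangular_def\<close>)
  finally have "proots (char_poly A) = mset es"
    by (simp only: proots_prod_linear)
  then have "rev (sorted_list_of_multiset (proots (char_poly A))) ! 1 < - a \<longleftrightarrow>
     (\<forall>i<n. \<forall>j<n. - a \<le> es ! i \<longrightarrow> - a \<le> es ! j \<longrightarrow> i = j)"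
    using sorted_list_nth_1_less_iff[of es] len vs by (simp add: n_def)
  also have "\<dots> \<longleftrightarrow> \<not> nonneg_plane (set vs) d a"
  proof -
    \<comment> \<open>\<open>y f i\<close> is the coordinate of \<open>f\<close> along the
      \<open>i\<close>-th column of \<open>P\<close>; these columns form an orthonormal basis of
      eigenvectors.\<close>
    define y where "y f i = (\<Sum>k<n. P $$ (k, i) * f (vs ! k))" for f i
    have y_lin: "y (\<lambda>u. s * f u + t * g u) i = s * y f i + t * y g i" for f g s t i
      by (simp add: y_def algebra_simps sum.distrib sum_distrib_left)
    have PtP: "(\<Sum>k<n. P $$ (k, i) * P $$ (k, j)) = (if i = j then 1 else 0)" if "i < n" "j < n" for i j
    proof -
      have "(P\<^sup>T * P) $$ (i, j) = (\<Sum>k<n. P $$ (k, i) * P $$ (k, j))"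
        using that P(1) by (simp add: scalar_prod_def atLeast0LessThan)
      then show ?thesis unfolding P(2) using that by simp
    qed
    have PPt: "(\<Sum>k<n. P $$ (i, k) * P $$ (j, k)) = (if i = j then 1 else 0)" if "i < n" "j < n" for i j
    proof -
      have "(P * P\<^sup>T) $$ (i, j) = (\<Sum>k<n. P $$ (i, k) * P $$ (j, k))"
        using that P(1) by (simp add: scalar_prod_def atLeast0LessThan)
      then show ?thesis unfolding PP using that by simp
    qed
    have Aij: "A $$ (i, j) = (\<Sum>k<n. es ! k * P $$ (i, k) * P $$ (j, k))" if "i < n" "j < n" for i j
    proof -
      have Pt: "P\<^sup>T \<in> carrier_mat n n" using P by simp
      have "P * D * P\<^sup>T = (P * P\<^sup>T) * A * (P * P\<^sup>T)"
        unfolding D_def using P(1) A Pt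
        by (simp add: assoc_mult_mat[of _ n n _ n _ n])
      moreover define E where "E = P * D"
      ultimately have "A = E * P\<^sup>T" using A by (simp add: PP)
      moreover have E: "E \<in> carrier_mat n n" using P(1) D by (simp add: E_def)
      ultimately have "A $$ (i, j) = (\<Sum>k<n. E $$ (i, k) * P $$ (j, k))"
        using that P(1) by (simp add: scalar_prod_def atLeast0LessThan)
      also have "\<dots> = (\<Sum>k<n. es ! k * P $$ (i, k) * P $$ (j, k))"
      proof (rule sum.cong)
        fix k assume "k \<in> {..<n}"
        then have k: "k < n" by simp
        have "E $$ (i, k) = (\<Sum>l<n. P $$ (i, l) * D $$ (l, k))"
          using that k P(1) D by (simp add: E_def scalar_prod_def atLeast0LessThan)
        also have "\<dots> = (\<Sum>l<n. if l = k then P $$ (i, k) * es ! k else 0)"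
          using diag D k by (intro sum.cong) (auto simp: D_def diagonal_mat_def es_def diag_mat_def)
        finally show "E $$ (i, k) * P $$ (j, k) = es ! k * P $$ (i, k) * P $$ (j, k)"
          using k by simp
      qed simp
      finally show ?thesis .
    qed
    have reindex: "(\<Sum>u\<in>set vs. h u) = (\<Sum>i<n. h (vs ! i))" for h :: "'a \<Rightarrow> real"
      using vs(1) by (simp add: sum.distinct_set_conv_list sum_list_sum_nth atLeast0LessThan n_def)
    have norm: "(\<Sum>u\<in>set vs. (f u)\<^sup>2) = (\<Sum>i<n. (y f i)\<^sup>2)" for f
    proof -
      have "(\<Sum>i<n. (y f i)\<^sup>2)
          = (\<Sum>i<n. \<Sum>k<n. \<Sum>l<n. f (vs ! k) * f (vs ! l) * (P $$ (k, i) * P $$ (l, i)))"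
        by (simp add: y_def power2_eq_square sum_product mult_ac)
      also have "\<dots> = (\<Sum>k<n. \<Sum>l<n. \<Sum>i<n. f (vs ! k) * f (vs ! l) * (P $$ (k, i) * P $$ (l, i)))"
        by (subst sum.swap) (rule sum.cong[OF refl], rule sum.swap)
      also have "\<dots> = (\<Sum>k<n. \<Sum>l<n. if l = k then f (vs ! k) * f (vs ! l) else 0)"
        by (intro sum.cong refl) (auto simp: PPt simp flip: sum_distrib_left)
      also have "\<dots> = (\<Sum>u\<in>set vs. (f u)\<^sup>2)"
        by (simp add: reindex power2_eq_square)
      finally show ?thesis ..
    qed
    have quad: "(\<Sum>u\<in>set vs. \<Sum>v\<in>set vs. d u v * f u * f v) = (\<Sum>i<n. es ! i * (y f i)\<^sup>2)" for f
    proof -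
      have "(\<Sum>i<n. es ! i * (y f i)\<^sup>2)
          = (\<Sum>i<n. \<Sum>k<n. \<Sum>l<n. f (vs ! k) * f (vs ! l) * (es ! i * P $$ (k, i) * P $$ (l, i)))"
        by (simp add: y_def power2_eq_square sum_product sum_distrib_left mult_ac)
      also have "\<dots> = (\<Sum>k<n. \<Sum>l<n. \<Sum>i<n. f (vs ! k) * f (vs ! l) * (es ! i * P $$ (k, i) * P $$ (l, i)))"
        by (subst sum.swap) (rule sum.cong[OF refl], rule sum.swap)
      also have "\<dots> = (\<Sum>k<n. \<Sum>l<n. f (vs ! k) * f (vs ! l) * A $$ (k, l))"
        by (intro sum.cong refl) (simp add: Aij flip: sum_distrib_left)
      also have "\<dots> = (\<Sum>u\<in>set vs. \<Sum>v\<in>set vs. d u v * f u * f v)"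
        unfolding reindex by (simp add: A_def n_def mult_ac)
      finally show ?thesis ..
    qed
    have form: "shifted_form (set vs) d a f = (\<Sum>i<n. (es ! i + a) * (y f i)\<^sup>2)" for f
      unfolding shifted_form_def quad norm by (simp add: algebra_simps sum.distrib sum_distrib_left)
    have y0: "f u = 0" if "\<And>i. i < n \<Longrightarrow> y f i = 0" "u \<in> set vs" for f u
    proof -
      have "(\<Sum>u\<in>set vs. (f u)\<^sup>2) = 0" unfolding norm using that(1) by simp
      then show ?thesis using that(2) by (subst (asm) sum_nonneg_eq_0_iff) auto
    qed
    show ?thesis
    proof
      assume *: "\<forall>i<n. \<forall>j<n. - a \<le> es ! i \<longrightarrow> - a \<le> es ! j \<longrightarrow> i = j"
      show "\<not> nonneg_plane (set vs) d a"
      proof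
        assume "nonneg_plane (set vs) d a"
        then obtain f g where
          indep: "\<And>s t. \<forall>u\<in>set vs. s * f u + t * g u = 0 \<Longrightarrow> s = 0 \<and> t = 0" and
          nonneg: "\<And>s t. 0 \<le> shifted_form (set vs) d a (\<lambda>u. s * f u + t * g u)"
          unfolding nonneg_plane_def by blast
        \<comment> \<open>\<open>k\<close> is the position of the only eigenvalue \<ge>
          \<open>- a\<close>; if there is none, any \<open>k\<close> serves.\<close>
        obtain k where k: "\<And>i. i < n \<Longrightarrow> i \<noteq> k \<Longrightarrow> es ! i < - a"
          using * by (metis not_le)
        \<comment> \<open>A linear functional on a plane has a nontrivial zero; here the functional
          is the \<open>k\<close>-th coordinate.\<close>
        obtain s t where st: "s * y f k + t * y g k = 0" "s \<noteq> 0 \<or> t \<noteq> 0"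
        proof (cases "y f k = 0")
          case True
          then show ?thesis using that[of 1 0] by simp
        next
          case False
          then show ?thesis using that[of "y g k" "- y f k"] by simp
        qed
        define h where "h u = s * f u + t * g u" for u
        have yk: "y h k = 0" unfolding h_def y_lin using st by simp
        obtain u where "u \<in> set vs" "h u \<noteq> 0"
          using indep[of s t] st(2) unfolding h_def by blast
        then obtain i where i: "i < n" "y h i \<noteq> 0" using y0[of h u] by blast
        have "(\<Sum>i<n. (es ! i + a) * (y h i)\<^sup>2) < (\<Sum>i<n. 0)"
        proof (rule sum_strict_mono_ex1)
          show "\<forall>i\<in>{..<n}. (es ! i + a) * (y h i)\<^sup>2 \<le> 0"
          proof
            fix i assume "i \<in> {..<n}"
            then show "(es ! i + a) * (y h i)\<^sup>2 \<le> 0"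
              using k[of i] yk by (cases "i = k") (auto simp: mult_le_0_iff)
          qed
          have "i \<noteq> k" using i yk by auto
          then show "\<exists>i\<in>{..<n}. (es ! i + a) * (y h i)\<^sup>2 < 0"
            using i k[of i] by (intro bexI[of _ i]) (auto simp: mult_less_0_iff)
        qed simp
        then have "shifted_form (set vs) d a h < 0" unfolding form by simp
        then show False using nonneg[of s t] unfolding h_def by linarith
      qed
    next
      assume *: "\<not> nonneg_plane (set vs) d a"
      show "\<forall>i<n. \<forall>j<n. - a \<le> es ! i \<longrightarrow> - a \<le> es ! j \<longrightarrow> i = j"
      proof (intro allI impI, rule ccontr)
        fix i j assume ij: "i < n" "j < n" "- a \<le> es ! i" "- a \<le> es ! j" "i \<noteq> j"
        \<comment> \<open>\<open>c i\<close> is the \<open>i\<close>-th eigenvector read as a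
          function on the vertices; the definite description recovers the position of a vertex in
          \<open>vs\<close>.\<close>
        define c where "c i u = P $$ ((THE k. k < n \<and> vs ! k = u), i)" for i u
        have the: "(THE k'. k' < n \<and> vs ! k' = vs ! k) = k" if "k < n" for k
          using that vs(1) by (auto simp: n_def nth_eq_iff_index_eq)
        have yc: "y (c i) j = (if i = j then 1 else 0)" if "i < n" "j < n" for i j
          using that PtP[of j i] by (auto simp: y_def c_def the)
        have y_comb: "y (\<lambda>u. s * c i u + t * c j u) k = s * (if i = k then 1 else 0) + t * (if j = k then 1 else 0)"
          if "k < n" for s t k
          using that ij by (simp only: y_lin yc)
        have "s = 0 \<and> t = 0" if "\<forall>u\<in>set vs. s * c i u + t * c j u = 0" for s t
        proof -
          have "s * (if i = k then 1 else 0) + t * (if j = k then 1 else 0) = 0" if "k < n" for k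
            using \<open>\<forall>u\<in>set vs. _ u = 0\<close> y_comb[OF that, of s t] by (simp add: y_def n_def)
          from this[of i] this[of j] ij show ?thesis by auto
        qed
        moreover have "0 \<le> shifted_form (set vs) d a (\<lambda>u. s * c i u + t * c j u)" for s t
          unfolding form by (intro sum_nonneg) (use ij in \<open>auto simp: y_comb\<close>)
        ultimately have "nonneg_plane (set vs) d a"
          unfolding nonneg_plane_def by blast
        with * show False by blast
      qed
    qed
  qed
  finally show ?thesis .
qed

subsection \<open>Cones over disjoint unions of cliques\<close>

text \<open>\<open>ns\<close> lists the orders of the cliques that remain when the dominating vertex is removed.\<close>

definition clique_cone :: "'a pair_pre_digraph \<Rightarrow> nat list \<Rightarrow> bool" where
  "clique_cone G ns \<longleftrightarrow> (\<exists>c k. c \<in> pverts G \<and>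
     (\<forall>u\<in>pverts G - {c}. k u < length ns) \<and>
     (\<forall>i<length ns. card {u \<in> pverts G - {c}. k u = i} = ns ! i) \<and>
     (\<forall>u\<in>pverts G. \<forall>v\<in>pverts G.
        (u, v) \<in> parcs G \<longleftrightarrow> u \<noteq> v \<and> (u = c \<or> v = c \<or> k u = k v)))"

text \<open>For two vertices of \<open>U\<close> the distance is 2, minus 1 if they share a clique,
  minus 1 more if they coincide. Each of the three terms sums to a square or a sum of squares, and
  the pairs containing \<open>c\<close> contribute the mixed term.\<close>

lemma shifted_form_cone:
  fixes f :: "'a \<Rightarrow> real" and k :: "'a \<Rightarrow> nat"
  assumes fin: "finite U" and c: "c \<notin> U" and k: "\<And>u. u \<in> U \<Longrightarrow> k u < m"
    and dcc: "d c c = 0" and dc: "\<And>u. u \<in> U \<Longrightarrow> d c u = 1 \<and> d u c = 1"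
    and dU: "\<And>u v. u \<in> U \<Longrightarrow> v \<in> U \<Longrightarrow> d u v = (if u = v then 0 else if k u = k v then 1 else 2)"
  defines "s \<equiv> \<lambda>i. \<Sum>u | u \<in> U \<and> k u = i. f u"
  shows "shifted_form (insert c U) d a f =
    a * (f c)\<^sup>2 + 2 * f c * (\<Sum>i<m. s i) + 2 * (\<Sum>i<m. s i)\<^sup>2 - (\<Sum>i<m. (s i)\<^sup>2)
      - (1 - a) * (\<Sum>u\<in>U. (f u)\<^sup>2)"
proof -
  have group: "(\<Sum>i<m. \<Sum>u | u \<in> U \<and> k u = i. g u) = (\<Sum>u\<in>U. g u)" for g :: "'a \<Rightarrow> real"
    by (rule sum.group) (use fin k in auto)
  have S: "(\<Sum>i<m. s i) = (\<Sum>u\<in>U. f u)" unfolding s_def by (rule group)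
  have same: "(\<Sum>i<m. (s i)\<^sup>2) = (\<Sum>u\<in>U. \<Sum>v\<in>U. if k u = k v then f u * f v else 0)"
  proof -
    have "(s i)\<^sup>2 = (\<Sum>u | u \<in> U \<and> k u = i. \<Sum>v\<in>U. if k u = k v then f u * f v else 0)" for i
    proof -
      have "(s i)\<^sup>2 = (\<Sum>u | u \<in> U \<and> k u = i. \<Sum>v | v \<in> U \<and> k v = i. f u * f v)"
        by (simp add: s_def power2_eq_square sum_product)
      also have "\<dots> = (\<Sum>u | u \<in> U \<and> k u = i. \<Sum>v\<in>U. if k u = k v then f u * f v else 0)"
        by (rule sum.cong[OF refl]) (auto simp: sum.inter_filter[OF fin] intro!: sum.cong)
      finally show ?thesis .
    qed
    then show ?thesis by (simp only: group)
  qed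
  have "(\<Sum>u\<in>U. \<Sum>v\<in>U. d u v * f u * f v)
      = (\<Sum>u\<in>U. \<Sum>v\<in>U. 2 * (f u * f v) - (if k u = k v then f u * f v else 0) - (if v = u then f u * f v else 0))"
    by (intro sum.cong refl) (auto simp: dU)
  also have "\<dots> = 2 * (\<Sum>u\<in>U. f u)\<^sup>2 - (\<Sum>i<m. (s i)\<^sup>2) - (\<Sum>u\<in>U. (f u)\<^sup>2)"
    unfolding same using fin by (simp add: sum_subtractf power2_eq_square sum_product flip: sum_distrib_left)
  finally have UU: "(\<Sum>u\<in>U. \<Sum>v\<in>U. d u v * f u * f v)
      = 2 * (\<Sum>u\<in>U. f u)\<^sup>2 - (\<Sum>i<m. (s i)\<^sup>2) - (\<Sum>u\<in>U. (f u)\<^sup>2)" .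
  have "(\<Sum>u\<in>insert c U. \<Sum>v\<in>insert c U. d u v * f u * f v)
      = 2 * f c * (\<Sum>u\<in>U. f u) + (\<Sum>u\<in>U. \<Sum>v\<in>U. d u v * f u * f v)"
    using fin c by (simp add: dcc dc sum.distrib flip: sum_distrib_left sum_distrib_right)
  then show ?thesis
    unfolding shifted_form_def S UU using fin c by (simp add: algebra_simps)
qed

text \<open>Equality holds for \<open>s i = 1 / b i\<close>; that choice yields the extremal plane
  for cones.\<close>

lemma weighted_Cauchy_Schwarz:
  fixes s b :: "'b \<Rightarrow> real"
  assumes "\<And>i. i \<in> I \<Longrightarrow> b i > 0"
  shows "(\<Sum>i\<in>I. s i)\<^sup>2 \<le> (\<Sum>i\<in>I. 1 / b i) * (\<Sum>i\<in>I. b i * (s i)\<^sup>2)"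
proof -
  have "(\<Sum>i\<in>I. s i) = (\<Sum>i\<in>I. (1 / sqrt (b i)) * (sqrt (b i) * s i))"
    by (rule sum.cong) (use assms in force)+
  then have "(\<Sum>i\<in>I. s i)\<^sup>2 \<le> (\<Sum>i\<in>I. (1 / sqrt (b i))\<^sup>2) * (\<Sum>i\<in>I. (sqrt (b i) * s i)\<^sup>2)"
    by (simp only: Cauchy_Schwarz_ineq_sum)
  also have "(\<Sum>i\<in>I. (1 / sqrt (b i))\<^sup>2) = (\<Sum>i\<in>I. 1 / b i)"
    by (rule sum.cong) (use assms in \<open>auto simp: power_divide less_imp_le\<close>)
  also have "(\<Sum>i\<in>I. (sqrt (b i) * s i)\<^sup>2) = (\<Sum>i\<in>I. b i * (s i)\<^sup>2)"
    by (rule sum.cong) (use assms in \<open>auto simp: power_mult_distrib less_imp_le\<close>)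
  finally show ?thesis .
qed

text \<open>Completing the square in the value at \<open>c\<close> leaves one positive square and a
  form in the clique sums. By Cauchy-Schwarz the latter is negative definite if
  \<open>\<kappa> * T < 1\<close>, and otherwise it is nonnegative at the equality case, which
  together with the indicator of \<open>c\<close> spans the plane.\<close>

lemma nonneg_plane_cone_iff:
  fixes k :: "'a \<Rightarrow> nat" and a :: real
  assumes fin: "finite U" and c: "c \<notin> U" and k: "\<And>u. u \<in> U \<Longrightarrow> k u < m"
    and dcc: "d c c = 0" and dc: "\<And>u. u \<in> U \<Longrightarrow> d c u = 1 \<and> d u c = 1"
    and dU: "\<And>u v. u \<in> U \<Longrightarrow> v \<in> U \<Longrightarrow> d u v = (if u = v then 0 else if k u = k v then 1 else 2)"
    and card: "\<And>i. i < m \<Longrightarrow> card {u. u \<in> U \<and> k u = i} = n i" and n: "\<And>i. i < m \<Longrightarrow> n i > 0"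
    and m: "m > 0" and a: "1 / 2 < a" "a < 1"
  shows "nonneg_plane (insert c U) d a \<longleftrightarrow>
    a / (2 * a - 1) \<le> (\<Sum>i<m. real (n i) / (real (n i) + (1 - a)))"
proof -
  define b where "b i = 1 + (1 - a) / real (n i)" for i
  have b: "b i > 0" "1 / b i = real (n i) / (real (n i) + (1 - a))" if "i < m" for i
    using n[OF that] a by (auto simp: b_def add_pos_pos divide_simps)
  define T where "T = (\<Sum>i<m. 1 / b i)"
  have T_eq: "T = (\<Sum>i<m. real (n i) / (real (n i) + (1 - a)))"
    by (simp add: T_def b)
  have T0: "T > 0"
    unfolding T_def using b(1) m by (intro sum_pos) auto
  \<comment> \<open>The coefficient of the squared total sum after completing the square; it is
    positive because \<open>a > 1 / 2\<close>.\<close>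
  define \<kappa> where "\<kappa> = 2 - 1 / a"
  have \<kappa>: "\<kappa> > 0" "1 / \<kappa> = a / (2 * a - 1)" using a by (auto simp: \<kappa>_def field_simps)
  define s where "s f i = (\<Sum>u | u \<in> U \<and> k u = i. f u)" for f :: "'a \<Rightarrow> real" and i
  have form: "shifted_form (insert c U) d a f =
      a * (f c)\<^sup>2 + 2 * f c * (\<Sum>i<m. s f i) + 2 * (\<Sum>i<m. s f i)\<^sup>2 - (\<Sum>i<m. (s f i)\<^sup>2)
      - (1 - a) * (\<Sum>u\<in>U. (f u)\<^sup>2)" for f
    unfolding s_def by (rule shifted_form_cone) (use fin c k dcc dc dU in auto)
  have group: "(\<Sum>i<m. \<Sum>u | u \<in> U \<and> k u = i. g u) = (\<Sum>u\<in>U. g u)" for g :: "'a \<Rightarrow> real"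
    by (rule sum.group) (use fin k in auto)
  have "1 / \<kappa> \<le> T" if np: "nonneg_plane (insert c U) d a"
  proof (rule ccontr)
    assume "\<not> 1 / \<kappa> \<le> T"
    then have T: "\<kappa> * T < 1" using \<kappa>(1) by (simp add: field_simps)
    obtain f g where
      indep: "\<And>p q. \<forall>u\<in>insert c U. p * f u + q * g u = 0 \<Longrightarrow> p = 0 \<and> q = 0" and
      nonneg: "\<And>p q. 0 \<le> shifted_form (insert c U) d a (\<lambda>u. p * f u + q * g u)"
      using np unfolding nonneg_plane_def by blast
    \<comment> \<open>\<open>l h / a\<close> is the quantity inside the completed square. Some
      nonzero vector \<open>h\<close> of the plane annihilates it, which removes the only positive
      square.\<close>
    define l where "l h = a * h c + (\<Sum>i<m. s h i)" for h
    have l_lin: "l (\<lambda>u. p * f u + q * g u) = p * l f + q * l g" for p q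
      by (simp add: l_def s_def sum.distrib sum_distrib_left algebra_simps)
    obtain p q where pq: "p * l f + q * l g = 0" "p \<noteq> 0 \<or> q \<noteq> 0"
    proof (cases "l f = 0")
      case True
      then show ?thesis using that[of 1 0] by simp
    next
      case False
      then show ?thesis using that[of "l g" "- l f"] by simp
    qed
    define h where "h u = p * f u + q * g u" for u
    have lh: "l h = 0" unfolding h_def l_lin by (rule pq)
    define S where "S = (\<Sum>i<m. s h i)"
    have hc: "h c = - S / a" using lh a by (simp add: l_def S_def field_simps)
    have Q: "shifted_form (insert c U) d a h = \<kappa> * S\<^sup>2 - (\<Sum>i<m. (s h i)\<^sup>2) - (1 - a) * (\<Sum>u\<in>U. (h u)\<^sup>2)"
      unfolding form S_def[symmetric] hc using a by (simp add: \<kappa>_def power2_eq_square field_simps)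
    \<comment> \<open>Cauchy-Schwarz within one clique: for a given sum, the sum of squares is least
      when \<open>h\<close> is constant on the clique.\<close>
    have "(s h i)\<^sup>2 \<le> real (n i) * (\<Sum>u | u \<in> U \<and> k u = i. (h u)\<^sup>2)" if "i < m" for i
      using sum_squared_le_sum_of_squares[of h "{u. u \<in> U \<and> k u = i}"] card[OF that]
      by (simp add: s_def mult.commute)
    then have "(s h i)\<^sup>2 / real (n i) \<le> (\<Sum>u | u \<in> U \<and> k u = i. (h u)\<^sup>2)" if "i < m" for i
      using that n[OF that] by (simp add: divide_le_eq mult.commute)
    then have "(\<Sum>i<m. (s h i)\<^sup>2 / real (n i)) \<le> (\<Sum>i<m. \<Sum>u | u \<in> U \<and> k u = i. (h u)\<^sup>2)"
      by (intro sum_mono) auto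
    then have le: "(\<Sum>i<m. (s h i)\<^sup>2 / real (n i)) \<le> (\<Sum>u\<in>U. (h u)\<^sup>2)"
      by (simp only: group)
    define B where "B = (\<Sum>i<m. b i * (s h i)\<^sup>2)"
    have B: "B = (\<Sum>i<m. (s h i)\<^sup>2) + (1 - a) * (\<Sum>i<m. (s h i)\<^sup>2 / real (n i))"
      by (simp add: B_def b_def algebra_simps sum.distrib sum_distrib_left add_divide_distrib sum_subtractf diff_divide_distrib)
    have CS: "S\<^sup>2 \<le> T * B"
      unfolding S_def T_def B_def by (rule weighted_Cauchy_Schwarz) (use b in auto)
    have "shifted_form (insert c U) d a h < 0"
    \<comment> \<open>If all clique sums vanish, strictness comes from the squares of
      \<open>h\<close> on \<open>U\<close>, since then \<open>h c = 0\<close> as well. Otherwise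
      \<open>B > 0\<close> and strictness comes from \<open>\<kappa> * T < 1\<close>.\<close>
    proof (cases "\<forall>i<m. s h i = 0")
      case True
      then have S0: "S = 0" by (simp add: S_def)
      have "(\<Sum>u\<in>U. (h u)\<^sup>2) \<noteq> 0"
      proof
        assume "(\<Sum>u\<in>U. (h u)\<^sup>2) = 0"
        then have "\<forall>u\<in>insert c U. h u = 0"
          using fin S0 hc by (simp add: sum_nonneg_eq_0_iff)
        then show False using indep[of p q] pq(2) unfolding h_def by blast
      qed
      then have "(\<Sum>u\<in>U. (h u)\<^sup>2) > 0" by (simp add: sum_nonneg less_le)
      then show ?thesis unfolding Q S0 using True a by simp
    next
      case False
      then obtain i where "i < m" "s h i \<noteq> 0" by blast
      then have "B > 0"
        unfolding B_def using b(1) by (intro sum_pos2[of _ i]) (auto simp: zero_le_mult_iff less_imp_le)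
      have "\<kappa> * S\<^sup>2 \<le> (\<kappa> * T) * B" using CS \<kappa>(1) by (simp add: mult.assoc)
      also have "\<dots> < B" using T \<open>B > 0\<close> by simp
      finally have "\<kappa> * S\<^sup>2 < (\<Sum>i<m. (s h i)\<^sup>2) + (1 - a) * (\<Sum>i<m. (s h i)\<^sup>2 / real (n i))"
        unfolding B .
      also have "\<dots> \<le> (\<Sum>i<m. (s h i)\<^sup>2) + (1 - a) * (\<Sum>u\<in>U. (h u)\<^sup>2)"
        using le a by simp
      finally show ?thesis unfolding Q by simp
    qed
    then show False using nonneg[of p q] unfolding h_def by linarith
  qed
  moreover have "nonneg_plane (insert c U) d a" if "1 / \<kappa> \<le> T"
  proof -
    have T: "1 \<le> \<kappa> * T" using that \<kappa>(1) by (simp add: field_simps)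
    \<comment> \<open>\<open>g\<close> is constant on each clique with clique sum
      \<open>1 / b i\<close>, so both Cauchy-Schwarz inequalities are equalities for it.\<close>
    define g where "g u = (if u = c then 0 else 1 / (b (k u) * real (n (k u))))" for u
    define f where "f u = (if u = c then 1 else 0 :: real)" for u
    have sg: "s (\<lambda>u. p * f u + q * g u) i = q / b i" if "i < m" for p q i
    proof -
      have "s (\<lambda>u. p * f u + q * g u) i = (\<Sum>u | u \<in> U \<and> k u = i. q / (b i * real (n i)))"
        unfolding s_def by (rule sum.cong) (use c in \<open>auto simp: f_def g_def\<close>)
      then show ?thesis using card[OF that] n[OF that] by simp
    qed
    have sq: "(\<Sum>u\<in>U. (p * f u + q * g u)\<^sup>2) = (\<Sum>i<m. q\<^sup>2 / ((b i)\<^sup>2 * real (n i)))" for p q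
    proof -
      have "(\<Sum>u\<in>U. (p * f u + q * g u)\<^sup>2) = (\<Sum>i<m. \<Sum>u | u \<in> U \<and> k u = i. (p * f u + q * g u)\<^sup>2)"
        by (rule group[symmetric])
      also have "\<dots> = (\<Sum>i<m. \<Sum>u | u \<in> U \<and> k u = i. (q / (b i * real (n i)))\<^sup>2)"
        by (intro sum.cong refl) (use c in \<open>auto simp: f_def g_def\<close>)
      also have "\<dots> = (\<Sum>i<m. q\<^sup>2 / ((b i)\<^sup>2 * real (n i)))"
        by (rule sum.cong) (use card n in \<open>auto simp: power2_eq_square\<close>)
      finally show ?thesis .
    qed
    have "shifted_form (insert c U) d a (\<lambda>u. p * f u + q * g u) \<ge> 0" for p q
    proof -
      have part: "(q / w)\<^sup>2 + (1 - a) * (q\<^sup>2 / (w\<^sup>2 * x)) = q\<^sup>2 / w\<^sup>2 * w"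
        if w: "w = 1 + (1 - a) / x" for w x
      proof -
        define r where "r = q\<^sup>2 / w\<^sup>2"
        have "(q / w)\<^sup>2 = r" "q\<^sup>2 / (w\<^sup>2 * x) = r / x"
          by (simp_all add: r_def power_divide)
        moreover have "r * w = r + (1 - a) * (r / x)" unfolding w by (simp add: distrib_left)
        ultimately show ?thesis unfolding r_def[symmetric] by simp
      qed
      have "(\<Sum>i<m. (q / b i)\<^sup>2) + (1 - a) * (\<Sum>i<m. q\<^sup>2 / ((b i)\<^sup>2 * real (n i)))
          = (\<Sum>i<m. q\<^sup>2 / (b i)\<^sup>2 * b i)"
        unfolding sum_distrib_left sum.distrib[symmetric]
        by (rule sum.cong[OF refl], rule part, rule b_def)
      also have "\<dots> = q\<^sup>2 * T"
        unfolding T_def sum_distrib_left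
        by (rule sum.cong) (use b(1) in \<open>force simp: power2_eq_square\<close>)+
      finally have *: "(\<Sum>i<m. (q / b i)\<^sup>2) + (1 - a) * (\<Sum>i<m. q\<^sup>2 / ((b i)\<^sup>2 * real (n i))) = q\<^sup>2 * T" .
      have S: "(\<Sum>i<m. q / b i) = q * T" by (simp add: T_def sum_distrib_left)
      have "shifted_form (insert c U) d a (\<lambda>u. p * f u + q * g u)
         = a * p\<^sup>2 + 2 * p * (\<Sum>i<m. q / b i) + 2 * (\<Sum>i<m. q / b i)\<^sup>2
           - ((\<Sum>i<m. (q / b i)\<^sup>2) + (1 - a) * (\<Sum>i<m. q\<^sup>2 / ((b i)\<^sup>2 * real (n i))))"
      proof -
        have "(\<Sum>i<m. s (\<lambda>u. p * f u + q * g u) i) = (\<Sum>i<m. q / b i)"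
          "(\<Sum>i<m. (s (\<lambda>u. p * f u + q * g u) i)\<^sup>2) = (\<Sum>i<m. (q / b i)\<^sup>2)"
          by (intro sum.cong refl; simp add: sg)+
        moreover have "p * f c + q * g c = p" by (simp add: f_def g_def)
        ultimately show ?thesis unfolding form sq by simp
      qed
      also have "\<dots> = a * p\<^sup>2 + 2 * p * (q * T) + 2 * (q * T)\<^sup>2 - q\<^sup>2 * T"
        unfolding * S ..
      also have "\<dots> = a * (p + q * T / a)\<^sup>2 + q\<^sup>2 * T * (\<kappa> * T - 1)"
        using a by (simp add: \<kappa>_def power2_eq_square field_simps)
      also have "\<dots> \<ge> 0" using a T T0 by simp
      finally show ?thesis .
    qed
    moreover have "p = 0 \<and> q = 0" if *: "\<forall>u\<in>insert c U. p * f u + q * g u = 0" for p q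
    proof
      show "p = 0" using * by (simp add: f_def g_def)
      \<comment> \<open>The clique with label 0 exists since \<open>m > 0\<close>, and
        \<open>g\<close> does not vanish on it.\<close>
      have "card {u. u \<in> U \<and> k u = 0} \<noteq> 0" using card[of 0] n[of 0] m by simp
      then obtain u where u: "u \<in> U" "k u = 0" by (auto simp: card_eq_0_iff)
      then have "q * g u = 0" "g u \<noteq> 0"
        using * \<open>p = 0\<close> c b(1)[of 0] n[of 0] m by (auto simp: g_def)
      then show "q = 0" by simp
    qed
    ultimately show ?thesis unfolding nonneg_plane_def by blast
  qed
  ultimately show ?thesis unfolding \<kappa>(2) T_eq by blast
qed

subsection \<open>Forbidden subgraphs\<close>

context pair_graph
begin

lemma graph_dist_eqI:
  assumes "apath u p v" "length p = n" "\<And>q. apath u q v \<Longrightarrow> n \<le> length q"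
  shows "graph_dist G u v = n"
  unfolding graph_dist_def by (rule Least_equality) (use assms in auto)

lemma graph_dist_self: "u \<in> pverts G \<Longrightarrow> graph_dist G u u = 0"
  by (rule graph_dist_eqI[of _ "[]"]) (auto simp: apath_simps)

lemma graph_dist_adj:
  assumes "(u, v) \<in> parcs G"
  shows "graph_dist G u v = 1"
proof (rule graph_dist_eqI[of _ "[(u, v)]"])
  show "apath u [(u, v)] v"
    using assms no_loops'[OF assms] by (auto simp: apath_simps dest: in_arcsD2)
  show "1 \<le> length q" if "apath u q v" for q
    using that no_loops'[OF assms] by (cases q) (auto simp: apath_simps)
qed simp

lemma graph_dist_two:
  assumes "u \<noteq> v" "(u, v) \<notin> parcs G" "(u, w) \<in> parcs G" "(w, v) \<in> parcs G"
  shows "graph_dist G u v = 2"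
proof (rule graph_dist_eqI[of _ "[(u, w), (w, v)]"])
  show "apath u [(u, w), (w, v)] v"
    using assms no_loops' by (auto simp: apath_simps dest: in_arcsD2)
  show "2 \<le> length q" if "apath u q v" for q
    using that assms by (cases q; cases "tl q") (auto simp: apath_simps)
qed simp

lemma graph_dist_three:
  assumes "u \<noteq> v" "(u, v) \<notin> parcs G" "\<And>w. (u, w) \<in> parcs G \<Longrightarrow> (w, v) \<notin> parcs G"
    "(u, x) \<in> parcs G" "(x, y) \<in> parcs G" "(y, v) \<in> parcs G"
  shows "graph_dist G u v = 3"
proof (rule graph_dist_eqI[of _ "[(u, x), (x, y), (y, v)]"])
  show "apath u [(u, x), (x, y), (y, v)] v"
    using assms no_loops' by (auto simp: apath_simps dest: in_arcsD2)
  show "3 \<le> length q" if "apath u q v" for q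
    using that assms by (cases q; cases "tl q"; cases "tl (tl q)") (auto simp: apath_simps)
qed simp

lemma graph_dist_commute: "graph_dist G u v = graph_dist G v u"
proof -
  have "(\<exists>p. apath u p v \<and> length p = k) \<longleftrightarrow> (\<exists>p. apath v p u \<and> length p = k)" for u v k
  proof -
    have "length (rev_path p) = length p" for p :: "('a \<times> 'a) list"
      by (induction p) auto
    then show ?thesis by (metis apath_rev_path)
  qed
  then show ?thesis by (simp add: graph_dist_def)
qed

end

text \<open>Extension by zero preserves both the values of the form and linear independence. Hence a
  plane supported on four vertices already obstructs the eigenvalue bound.\<close>

lemma nonneg_plane_mono:
  assumes "finite V" "W \<subseteq> V" "nonneg_plane W d a"
  shows "nonneg_plane V d a"
proof -
  obtain f g where
    indep: "\<And>s t. \<forall>u\<in>W. s * f u + t * g u = 0 \<Longrightarrow> s = 0 \<and> t = 0" and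
    nonneg: "\<And>s t. 0 \<le> shifted_form W d a (\<lambda>u. s * f u + t * g u)"
    using assms(3) unfolding nonneg_plane_def by blast
  define ext where "ext h u = (if u \<in> W then h u else 0)" for h :: "'a \<Rightarrow> real" and u
  have [simp]: "ext h u = h u" if "u \<in> W" for h u using that by (simp add: ext_def)
  have [simp]: "ext h u = 0" if "u \<notin> W" for h u using that by (simp add: ext_def)
  have "shifted_form V d a (\<lambda>u. s * ext f u + t * ext g u)
      = shifted_form W d a (\<lambda>u. s * f u + t * g u)" for s t
  proof -
    let ?h = "\<lambda>u. s * ext f u + t * ext g u" and ?k = "\<lambda>u. s * f u + t * g u"
    have "(\<Sum>u\<in>V. (?h u)\<^sup>2) = (\<Sum>u\<in>W. (?k u)\<^sup>2)"
      by (rule sum.mono_neutral_cong_right) (use assms in auto)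
    moreover have "(\<Sum>v\<in>V. d u v * ?h u * ?h v) = (\<Sum>v\<in>W. d u v * ?k u * ?k v)" if "u \<in> W" for u
      by (rule sum.mono_neutral_cong_right) (use assms that in auto)
    then have "(\<Sum>u\<in>V. \<Sum>v\<in>V. d u v * ?h u * ?h v) = (\<Sum>u\<in>W. \<Sum>v\<in>W. d u v * ?k u * ?k v)"
      by (intro sum.mono_neutral_cong_right) (use assms in auto)
    ultimately show ?thesis by (simp only: shifted_form_def)
  qed
  moreover have "s = 0 \<and> t = 0" if "\<forall>u\<in>V. s * ext f u + t * ext g u = 0" for s t
    using that assms(2) by (intro indep) (auto dest!: subsetD)
  ultimately show ?thesis using nonneg unfolding nonneg_plane_def by metis
qed

text \<open>Reduces the search for a plane to two lists of four coefficients. In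
  \<open>nonneg\<close> the diagonal is dropped and each of the six distances is counted twice;
  \<open>z\<close> stands for an arbitrary vector of the plane.\<close>

lemma nonneg_plane_4:
  assumes "distinct [p, q, r, s]"
    and sym: "\<And>u v. d u v = d v u"
    and "d p p = 0" "d q q = 0" "d r r = 0" "d s s = 0"
    and indep: "\<And>x y. \<forall>i\<in>{0..<4}. x * F ! i + y * H ! i = 0 \<Longrightarrow> x = 0 \<and> y = 0"
    and len: "length F = 4" "length H = 4"
    and nonneg: "\<And>x y z. (\<And>i. z i = x * F ! i + y * H ! i) \<Longrightarrow>
      0 \<le> 2 * (d p q * z 0 * z 1 + d p r * z 0 * z 2 + d p s * z 0 * z 3 + d q r * z 1 * z 2
        + d q s * z 1 * z 3 + d r s * z 2 * z 3)
        + a * ((z 0)\<^sup>2 + (z 1)\<^sup>2 + (z 2)\<^sup>2 + (z (3::nat))\<^sup>2)"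
  shows "nonneg_plane {p, q, r, s} d a"
proof -
  define ext where "ext K u = (if u = p then K ! 0 else if u = q then K ! 1 else if u = r then K ! 2 else K ! 3)"
    for K :: "real list" and u
  have ext: "ext K p = K ! 0" "ext K q = K ! 1" "ext K r = K ! 2" "ext K s = K ! 3" for K
    using assms(1) by (auto simp: ext_def)
  have "0 \<le> shifted_form {p, q, r, s} d a (\<lambda>u. x * ext F u + y * ext H u)" for x y
    using nonneg[of "\<lambda>i. x * F ! i + y * H ! i" x y, OF refl] assms(1,3-6)
      sym[of q p] sym[of r p] sym[of s p] sym[of r q] sym[of s q] sym[of s r]
    by (simp add: shifted_form_def ext algebra_simps)
  moreover have "x = 0 \<and> y = 0" if "\<forall>u\<in>{p, q, r, s}. x * ext F u + y * ext H u = 0" for x y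
    using that by (intro indep) (auto simp: ext numeral_eq_Suc less_Suc_eq)
  ultimately show ?thesis unfolding nonneg_plane_def by blast
qed

text \<open>\<open>(5, -12, 12, -5)\<close> is a rational approximation of the eigenvector for \<open>-2 + \<surd>2\<close>, and
  just good enough.\<close>

lemma nonneg_plane_isometric_P4:
  assumes "distinct [p, q, r, s]"
    and sym: "\<And>u v. d u v = d v u"
    and "d p p = 0" "d q q = 0" "d r r = 0" "d s s = 0"
    and "d p q = 1" "d p r = 2" "d p s = 3" "d q r = 1" "d q s = 2" "d r s = 1"
  shows "nonneg_plane {p, q, r, s} d 0.5858"
proof (rule nonneg_plane_4[where d = d, OF assms(1-6), where F = "[1, 1, 1, 1]" and H = "[5, -12, 12, -5]"])
  fix x y :: real and z :: "nat \<Rightarrow> real"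
  assume z: "\<And>i. z i = x * [1, 1, 1, 1] ! i + y * [5, -12, 12, -5] ! i"
  \<comment> \<open>Reversing the path fixes the first vector and negates the second, so no term in
    \<open>x * y\<close> survives. The coefficient of \<open>y\<^sup>2\<close> is
    \<open>338 * 0.5858 - 198\<close>.\<close>
  have "2 * (d p q * z 0 * z 1 + d p r * z 0 * z 2 + d p s * z 0 * z 3 + d q r * z 1 * z 2
        + d q s * z 1 * z 3 + d r s * z 2 * z 3)
        + 0.5858 * ((z 0)\<^sup>2 + (z 1)\<^sup>2 + (z 2)\<^sup>2 + (z (3::nat))\<^sup>2)
      = 22.3432 * (x)\<^sup>2 + 0.0004 * y\<^sup>2"
    by (simp add: assms(7-12) z numeral_eq_Suc power2_eq_square algebra_simps) (simp add: field_simps)?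
  then show "0 \<le> 2 * (d p q * z 0 * z 1 + d p r * z 0 * z 2 + d p s * z 0 * z 3 + d q r * z 1 * z 2
        + d q s * z 1 * z 3 + d r s * z 2 * z 3)
        + 0.5858 * ((z 0)\<^sup>2 + (z 1)\<^sup>2 + (z 2)\<^sup>2 + (z (3::nat))\<^sup>2)"
    by simp
next
  fix x y :: real
  assume "\<forall>i\<in>{0..<4}. x * [1, 1, 1, 1] ! i + y * [5, -12, 12, -5] ! i = 0"
  from bspec[OF this, of 0] bspec[OF this, of 1] show "x = 0 \<and> y = 0" by simp
qed simp_all

text \<open>Here the path is induced but its ends are at distance 2, as happens in diameter 2. The
  two vectors are symmetric and antisymmetric under reversal of the path, hence orthogonal for the
  form.\<close>

lemma nonneg_plane_P4:
  assumes "distinct [p, q, r, s]"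
    and sym: "\<And>u v. d u v = d v u"
    and "d p p = 0" "d q q = 0" "d r r = 0" "d s s = 0"
    and "d p q = 1" "d p r = 2" "d p s = 2" "d q r = 1" "d q s = 2" "d r s = 1"
  shows "nonneg_plane {p, q, r, s} d 0.5858"
proof (rule nonneg_plane_4[where d = d, OF assms(1-6), where F = "[1, 1, 1, 1]" and H = "[1, -2, 2, -1]"])
  fix x y :: real and z :: "nat \<Rightarrow> real"
  assume z: "\<And>i. z i = x * [1, 1, 1, 1] ! i + y * [1, -2, 2, -1] ! i"
  have "2 * (d p q * z 0 * z 1 + d p r * z 0 * z 2 + d p s * z 0 * z 3 + d q r * z 1 * z 2
        + d q s * z 1 * z 3 + d r s * z 2 * z 3)
        + 0.5858 * ((z 0)\<^sup>2 + (z 1)\<^sup>2 + (z 2)\<^sup>2 + (z (3::nat))\<^sup>2)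
      = 20.3432 * (x)\<^sup>2 + 1.8580 * y\<^sup>2"
    by (simp add: assms(7-12) z numeral_eq_Suc power2_eq_square algebra_simps) (simp add: field_simps)?
  then show "0 \<le> 2 * (d p q * z 0 * z 1 + d p r * z 0 * z 2 + d p s * z 0 * z 3 + d q r * z 1 * z 2
        + d q s * z 1 * z 3 + d r s * z 2 * z 3)
        + 0.5858 * ((z 0)\<^sup>2 + (z 1)\<^sup>2 + (z 2)\<^sup>2 + (z (3::nat))\<^sup>2)"
    by simp
next
  fix x y :: real
  assume "\<forall>i\<in>{0..<4}. x * [1, 1, 1, 1] ! i + y * [1, -2, 2, -1] ! i = 0"
  from bspec[OF this, of 0] bspec[OF this, of 1] show "x = 0 \<and> y = 0" by simp
qed simp_all

text \<open>Both vectors are eigenvectors of the distance matrix of the 4-cycle, with eigenvalues 4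
  and 0.\<close>

lemma nonneg_plane_C4:
  assumes "distinct [p, q, r, s]"
    and sym: "\<And>u v. d u v = d v u"
    and "d p p = 0" "d q q = 0" "d r r = 0" "d s s = 0"
    and "d p q = 1" "d p r = 2" "d p s = 1" "d q r = 1" "d q s = 2" "d r s = 1"
  shows "nonneg_plane {p, q, r, s} d 0.5858"
proof (rule nonneg_plane_4[where d = d, OF assms(1-6), where F = "[1, 1, 1, 1]" and H = "[1, -1, 1, -1]"])
  fix x y :: real and z :: "nat \<Rightarrow> real"
  assume z: "\<And>i. z i = x * [1, 1, 1, 1] ! i + y * [1, -1, 1, -1] ! i"
  have "2 * (d p q * z 0 * z 1 + d p r * z 0 * z 2 + d p s * z 0 * z 3 + d q r * z 1 * z 2
        + d q s * z 1 * z 3 + d r s * z 2 * z 3)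
        + 0.5858 * ((z 0)\<^sup>2 + (z 1)\<^sup>2 + (z 2)\<^sup>2 + (z (3::nat))\<^sup>2)
      = 18.3432 * (x)\<^sup>2 + 2.3432 * y\<^sup>2"
    by (simp add: assms(7-12) z numeral_eq_Suc power2_eq_square algebra_simps) (simp add: field_simps)?
  then show "0 \<le> 2 * (d p q * z 0 * z 1 + d p r * z 0 * z 2 + d p s * z 0 * z 3 + d q r * z 1 * z 2
        + d q s * z 1 * z 3 + d r s * z 2 * z 3)
        + 0.5858 * ((z 0)\<^sup>2 + (z 1)\<^sup>2 + (z 2)\<^sup>2 + (z (3::nat))\<^sup>2)"
    by simp
next
  fix x y :: real
  assume "\<forall>i\<in>{0..<4}. x * [1, 1, 1, 1] ! i + y * [1, -1, 1, -1] ! i = 0"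
  from bspec[OF this, of 0] bspec[OF this, of 1] show "x = 0 \<and> y = 0" by simp
qed simp_all

text \<open>The second vector is orthogonal to the first one with respect to the shifted form.\<close>

lemma nonneg_plane_diamond:
  assumes "distinct [p, q, r, s]"
    and sym: "\<And>u v. d u v = d v u"
    and "d p p = 0" "d q q = 0" "d r r = 0" "d s s = 0"
    and "d p q = 1" "d p r = 2" "d p s = 1" "d q r = 1" "d q s = 1" "d r s = 1"
  shows "nonneg_plane {p, q, r, s} d 0.5858"
proof (rule nonneg_plane_4[where d = d, OF assms(1-6), where F = "[1, 0, 1, 0]" and H = "[10000, -12929, 10000, -12929]"])
  fix x y :: real and z :: "nat \<Rightarrow> real"
  assume z: "\<And>i. z i = x * [1, 0, 1, 0] ! i + y * [10000, -12929, 10000, -12929] ! i"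
  have "2 * (d p q * z 0 * z 1 + d p r * z 0 * z 2 + d p s * z 0 * z 3 + d q r * z 1 * z 2
        + d q s * z 1 * z 3 + d r s * z 2 * z 3)
        + 0.5858 * ((z 0)\<^sup>2 + (z 1)\<^sup>2 + (z 2)\<^sup>2 + (z (3::nat))\<^sup>2)
      = 5.1716 * (x)\<^sup>2 + 13001614.4356 * y\<^sup>2"
    by (simp add: assms(7-12) z numeral_eq_Suc power2_eq_square algebra_simps) (simp add: field_simps)?
  then show "0 \<le> 2 * (d p q * z 0 * z 1 + d p r * z 0 * z 2 + d p s * z 0 * z 3 + d q r * z 1 * z 2
        + d q s * z 1 * z 3 + d r s * z 2 * z 3)
        + 0.5858 * ((z 0)\<^sup>2 + (z 1)\<^sup>2 + (z 2)\<^sup>2 + (z (3::nat))\<^sup>2)"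
    by simp
next
  fix x y :: real
  assume "\<forall>i\<in>{0..<4}. x * [1, 0, 1, 0] ! i + y * [10000, -12929, 10000, -12929] ! i = 0"
  from bspec[OF this, of 0] bspec[OF this, of 1] show "x = 0 \<and> y = 0" by simp
qed simp_all

section \<open>Diameter two and the cone structure\<close>

context pair_graph
begin

abbreviation dist_form :: "'a \<Rightarrow> 'a \<Rightarrow> real" where
  "dist_form u v \<equiv> real (graph_dist G u v)"

lemma dist_form_commute: "dist_form u v = dist_form v u"
  using graph_dist_commute[of u v] by simp

text \<open>\<open>N\<close> consists of the vertices at distance at most 2 from \<open>u\<close>.
  An edge leaving \<open>N\<close> would end at distance 3 and complete an isometric path on four
  vertices, so \<open>N\<close> is closed under adjacency and, by connectedness, contains
  \<open>v\<close>.\<close>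

lemma common_neighbour_if_no_nonneg_plane:
  assumes conn: "Digraph_Component.connected (with_proj G)"
    and np: "\<not> nonneg_plane (pverts G) dist_form 0.5858"
    and uv: "u \<in> pverts G" "v \<in> pverts G" "u \<noteq> v" "(u, v) \<notin> parcs G"
  obtains w where "(u, w) \<in> parcs G" "(w, v) \<in> parcs G"
proof -
  define N where "N = {x. x = u \<or> (u, x) \<in> parcs G \<or> (\<exists>w. (u, w) \<in> parcs G \<and> (w, x) \<in> parcs G)}"
  have step: "z \<in> N" if x: "x \<in> N" and xz: "(x, z) \<in> parcs G" for x z
  proof (rule ccontr)
    assume z: "z \<notin> N"
    have "x \<noteq> u" "(u, x) \<notin> parcs G" using z xz by (auto simp: N_def)
    with x obtain w where w: "(u, w) \<in> parcs G" "(w, x) \<in> parcs G" by (auto simp: N_def)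
    have wz: "w \<noteq> z" "(w, z) \<notin> parcs G" "u \<noteq> z" "(u, z) \<notin> parcs G"
      using z w by (auto simp: N_def)
    have dist: "distinct [u, w, x, z]"
      using \<open>x \<noteq> u\<close> wz no_loops'[OF w(1)] no_loops'[OF w(2)] no_loops'[OF xz] by auto
    have V: "{u, w, x, z} \<subseteq> pverts G"
      using w xz by (auto dest: in_arcsD1 in_arcsD2)
    have uz: "graph_dist G u z = 3"
      by (rule graph_dist_three[OF wz(3,4) _ w xz]) (use z in \<open>auto simp: N_def\<close>)
    have "nonneg_plane {u, w, x, z} dist_form 0.5858"
      by (rule nonneg_plane_isometric_P4[where d = dist_form, OF _ dist_form_commute])
        (use dist V w xz wz uz \<open>x \<noteq> u\<close> \<open>(u, x) \<notin> parcs G\<close> graph_dist_two[of u x w] graph_dist_two[of w z x]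
          in \<open>auto simp: graph_dist_self graph_dist_adj\<close>)
    then show False using np nonneg_plane_mono[OF pair_finite_verts V] by blast
  qed
  have "u \<rightarrow>\<^sup>*\<^bsub>with_proj G\<^esub> v"
    using symmetric_connected_imp_strongly_connected[OF pair_sym_arcs conn] uv
    by (auto elim: strongly_connectedE)
  then obtain p where "awalk u p v" unfolding reachable_awalk by blast
  moreover have "y \<in> N" if "awalk x p y" "x \<in> N" for x p y
    using that
  proof (induction p arbitrary: x)
    case (Cons e p)
    then have "(x, snd e) \<in> parcs G" "awalk (snd e) p y" by (auto simp: awalk_simps)
    with Cons step show ?case by blast
  qed (simp add: awalk_simps)
  ultimately have "v \<in> N" by (auto simp: N_def)
  then show thesis using uv that by (auto simp: N_def)
qed

text \<open>In diameter at most 2, excluding the induced path, the 4-cycle and the diamond first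
  yields a dominating vertex \<open>c\<close> and then makes adjacency transitive on the other
  vertices; the classes are the cliques.\<close>

lemma clique_cone_if_no_nonneg_plane:
  assumes conn: "Digraph_Component.connected (with_proj G)" and card: "card (pverts G) \<ge> 2"
    and np: "\<not> nonneg_plane (pverts G) dist_form 0.5858"
  obtains ns where "clique_cone G ns" "ns \<noteq> []" "\<forall>n\<in>set ns. n \<ge> 1"
proof -
  let ?E = "\<lambda>u v. (u, v) \<in> parcs G"
  have V: "u \<in> pverts G" "v \<in> pverts G" if "?E u v" for u v
    using that by (auto dest: in_arcsD1 in_arcsD2)
  note sym = arcs_symmetric
  have irr: "\<not> ?E u u" for u using no_loops' by blast
  have d2: "graph_dist G u v = 2" if "u \<in> pverts G" "v \<in> pverts G" "u \<noteq> v" "\<not> ?E u v" for u v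
    by (rule common_neighbour_if_no_nonneg_plane[OF conn np that]) (rule graph_dist_two[OF that(3,4)])
  have sub: False if "nonneg_plane W dist_form 0.5858" "W \<subseteq> pverts G" for W
    using np nonneg_plane_mono[OF pair_finite_verts that(2,1)] by blast
  have P4: False if "?E p q" "?E q r" "?E r s" "\<not> ?E p r" "\<not> ?E q s" "\<not> ?E p s" "p \<noteq> r" "q \<noteq> s" "p \<noteq> s" for p q r s
  proof -
    have "nonneg_plane {p, q, r, s} dist_form 0.5858"
      by (rule nonneg_plane_P4[where d = dist_form, OF _ dist_form_commute])
        (use that V[OF that(1)] V[OF that(3)] irr in \<open>auto simp: graph_dist_self graph_dist_adj d2\<close>)
    then show False by (rule sub) (use V that in auto)
  qed
  have C4: False if "?E p q" "?E q r" "?E r s" "?E p s" "\<not> ?E p r" "\<not> ?E q s" "p \<noteq> r" "q \<noteq> s" for p q r s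
  proof -
    have "nonneg_plane {p, q, r, s} dist_form 0.5858"
      by (rule nonneg_plane_C4[where d = dist_form, OF _ dist_form_commute])
        (use that V[OF that(1)] V[OF that(3)] irr in \<open>auto simp: graph_dist_self graph_dist_adj d2\<close>)
    then show False by (rule sub) (use V that in auto)
  qed
  have diamond: False if "?E p q" "?E q r" "?E r s" "?E p s" "?E q s" "\<not> ?E p r" "p \<noteq> r" for p q r s
  proof -
    have "nonneg_plane {p, q, r, s} dist_form 0.5858"
      by (rule nonneg_plane_diamond[where d = dist_form, OF _ dist_form_commute])
        (use that V[OF that(1)] V[OF that(3)] irr in \<open>auto simp: graph_dist_self graph_dist_adj d2\<close>)
    then show False by (rule sub) (use V that in auto)
  qed
  \<comment> \<open>In a graph that is not complete, \<open>c\<close> is a common neighbour of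
    nonadjacent \<open>u\<close> and \<open>w\<close>. If \<open>x\<close> were not adjacent to
    \<open>c\<close>, a common neighbour \<open>y\<close> of \<open>c\<close> and \<open>x\<close>
    would be adjacent to \<open>u\<close> and \<open>w\<close>, and \<open>u\<close>,
    \<open>y\<close>, \<open>w\<close>, \<open>c\<close> would induce a diamond.\<close>
  obtain c where c: "c \<in> pverts G" "\<And>x. x \<in> pverts G \<Longrightarrow> x \<noteq> c \<Longrightarrow> ?E c x"
  proof (cases "\<forall>u\<in>pverts G. \<forall>v\<in>pverts G. u \<noteq> v \<longrightarrow> ?E u v")
    case True
    have "pverts G \<noteq> {}" using card by auto
    then obtain c where "c \<in> pverts G" by blast
    with True show ?thesis by (intro that[of c]) auto
  next
    case False
    then obtain u w where uw: "u \<in> pverts G" "w \<in> pverts G" "u \<noteq> w" "\<not> ?E u w" by blast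
    obtain c where c: "?E u c" "?E c w"
      using common_neighbour_if_no_nonneg_plane[OF conn np uw] .
    \<comment> \<open>Otherwise \<open>x\<close>, \<open>y\<close>, \<open>c\<close>,
      \<open>z\<close> induce a 4-cycle or a path, according to whether \<open>x\<close> and
      \<open>z\<close> are adjacent.\<close>
    have nbr: "?E y z" if "?E c z" "?E c y" "?E y x" "\<not> ?E c x" "x \<noteq> c" "y \<noteq> z" for x y z
    proof (rule ccontr)
      assume yz: "\<not> ?E y z"
      have *: "?E x y" "?E y c" "?E c z" "\<not> ?E x c" "x \<noteq> c" "x \<noteq> z"
        using that(1,3-5) sym[OF that(2)] sym[OF that(3)] sym[of x c] by auto
      show False
      proof (cases "?E x z")
        case True
        then show ?thesis using C4[OF *(1-3) True *(4) yz *(5)] that(6) by blast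
      next
        case False
        then show ?thesis using P4[OF *(1-4) yz False *(5) that(6) *(6)] by blast
      qed
    qed
    have "?E c x" if x: "x \<in> pverts G" "x \<noteq> c" for x
    proof (rule ccontr)
      assume cx: "\<not> ?E c x"
      obtain y where y: "?E c y" "?E y x"
        using common_neighbour_if_no_nonneg_plane[OF conn np _ x(1) x(2)[symmetric] cx] V[OF c(1)] by blast
      have "y \<noteq> u \<Longrightarrow> ?E y u" "y \<noteq> w \<Longrightarrow> ?E y w"
        using nbr[OF _ y cx x(2)] c(2) sym[OF c(1)] by auto
      moreover have "y = u \<Longrightarrow> ?E u w" "y = w \<Longrightarrow> ?E w u"
        using calculation uw(3) by auto
      then have "y \<noteq> u" "y \<noteq> w" using uw(4) sym[of w u] by blast+
      ultimately have "?E u y" "?E y w" using sym[of y u] by blast+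
      moreover have "?E w c" "?E u c" "?E y c" using c y sym[of c w] sym[of c y] by blast+
      ultimately show False
        using diamond[of u y w c] uw(3,4) by blast
    qed
    then show ?thesis using V[OF c(1)] by (intro that[of c])
  qed
  define U where "U = pverts G - {c}"
  \<comment> \<open>A failure of transitivity at \<open>y\<close> would make \<open>x\<close>,
    \<open>y\<close>, \<open>z\<close>, \<open>c\<close> a diamond.\<close>
  have trans: "?E x z" if "x \<in> U" "y \<in> U" "z \<in> U" "?E x y" "?E y z" "x \<noteq> z" for x y z
    using diamond[of x y z c] that c(2)[THEN sym] unfolding U_def by blast
  define R where "R = {(x, y). x \<in> U \<and> y \<in> U \<and> (x = y \<or> ?E x y)}"
  have R: "equiv U R"
    unfolding equiv_def refl_on_def sym_on_def trans_on_def R_def using trans sym by blast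
  have finU: "finite U" using pair_finite_verts by (simp add: U_def)
  have fin: "finite (U // R)" using finU R by (metis equiv_def finite_quotient refl_on_def)
  define m where "m = card (U // R)"
  \<comment> \<open>\<open>clique_cone\<close> expects numerical labels, so the classes are numbered
    by \<open>h\<close>.\<close>
  obtain h where h: "bij_betw h (U // R) {0..<m}"
    using ex_bij_betw_finite_nat[OF fin] unfolding m_def by blast
  define k where "k u = h (R `` {u})" for u
  have k_less: "k u < m" if "u \<in> U" for u
    using h quotientI[OF that, of R] by (auto simp: k_def bij_betw_def)
  have k_eq: "k u = k v \<longleftrightarrow> u = v \<or> ?E u v" if "u \<in> U" "v \<in> U" for u v
  proof -
    have "k u = k v \<longleftrightarrow> R `` {u} = R `` {v}"
      unfolding k_def using h that by (auto simp: bij_betw_def inj_on_eq_iff quotientI)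
    also have "\<dots> \<longleftrightarrow> (u, v) \<in> R" using R that by (simp add: eq_equiv_class_iff)
    finally show ?thesis using that by (simp add: R_def)
  qed
  have k_surj: "\<exists>u\<in>U. k u = i" if "i < m" for i
  proof -
    have "i \<in> h ` (U // R)" using h that by (auto simp: bij_betw_def)
    then show ?thesis by (auto simp: k_def elim!: quotientE)
  qed
  define ns where "ns = map (\<lambda>i. card {u \<in> U. k u = i}) [0..<m]"
  have "clique_cone G ns"
    unfolding clique_cone_def
  proof (rule exI[of _ c], rule exI[of _ k], unfold U_def[symmetric], intro conjI ballI)
    show "c \<in> pverts G" by (rule c)
    show "\<forall>i<length ns. card {u \<in> U. k u = i} = ns ! i" by (simp add: ns_def)
    fix u v assume "u \<in> pverts G" "v \<in> pverts G"
    then show "?E u v \<longleftrightarrow> u \<noteq> v \<and> (u = c \<or> v = c \<or> k u = k v)"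
      using c sym[of c] irr k_eq[of u v] by (auto simp: U_def)
  qed (auto simp: ns_def k_less)
  moreover have "\<forall>n\<in>set ns. n \<ge> 1"
    using k_surj[unfolded Bex_def] finU by (auto simp: ns_def Suc_le_eq card_gt_0_iff)
  moreover have "U \<noteq> {}"
    using card c(1) pair_finite_verts by (auto simp: U_def dest!: subset_singletonD)
  then have "ns \<noteq> []" using k_less by (auto simp: ns_def)
  ultimately show thesis using that by blast
qed

text \<open>In a cone, two vertices of different cliques have the common neighbour \<open>c\<close>,
  so all distances are at most 2 and the computation for cones applies.\<close>

lemma nonneg_plane_iff_clique_cone:
  assumes cone: "clique_cone G ns" and pos: "ns \<noteq> []" "\<forall>n\<in>set ns. n \<ge> 1"
    and a: "1 / 2 < a" "a < 1"
  shows "nonneg_plane (pverts G) dist_form a \<longleftrightarrow>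
    a / (2 * a - 1) \<le> (\<Sum>n\<leftarrow>ns. real n / (real n + (1 - a)))"
proof -
  obtain c k where c: "c \<in> pverts G" and k: "\<forall>u\<in>pverts G - {c}. k u < length ns"
    and card: "\<forall>i<length ns. card {u \<in> pverts G - {c}. k u = i} = ns ! i"
    and arcs: "\<forall>u\<in>pverts G. \<forall>v\<in>pverts G. (u, v) \<in> parcs G \<longleftrightarrow> u \<noteq> v \<and> (u = c \<or> v = c \<or> k u = k v)"
    using cone unfolding clique_cone_def by blast
  have V: "pverts G = insert c (pverts G - {c})" using c by blast
  have "nonneg_plane (insert c (pverts G - {c})) dist_form a \<longleftrightarrow>
      a / (2 * a - 1) \<le> (\<Sum>i<length ns. real (ns ! i) / (real (ns ! i) + (1 - a)))"
  proof (rule nonneg_plane_cone_iff)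
    fix u v assume uv: "u \<in> pverts G - {c}" "v \<in> pverts G - {c}"
    then show "dist_form u v = (if u = v then 0 else if k u = k v then 1 else 2)"
      using arcs c graph_dist_self[of u] graph_dist_adj[of u v] graph_dist_two[of u v c] by auto
  next
    fix i assume "i < length ns"
    then show "0 < ns ! i" using pos(2) nth_mem[of i ns] by fastforce
  qed (use c k card arcs pos(1) a pair_finite_verts graph_dist_self graph_dist_adj in auto)
  then show ?thesis
    using V by (simp add: sum_list_sum_nth atLeast0LessThan)
qed

end

subsection \<open>Isomorphism with the named graphs\<close>

text \<open>A digraph isomorphism carries separate maps for vertices, arcs, heads and tails. Arcs
  here are pairs with \<open>fst\<close> and \<open>snd\<close> as end points, so the vertex map
  determines the rest.\<close>

lemma graph_iso_iff_bij:
  assumes "pair_wf_digraph G" "pair_wf_digraph H"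
  shows "G \<cong>\<^sub>g H \<longleftrightarrow> (\<exists>f. bij_betw f (pverts G) (pverts H) \<and>
    (\<forall>u\<in>pverts G. \<forall>v\<in>pverts G. (u, v) \<in> parcs G \<longleftrightarrow> (f u, f v) \<in> parcs H))"
    (is "_ \<longleftrightarrow> (\<exists>f. ?iso f)")
proof
  interpret G: pair_wf_digraph G by fact
  assume "G \<cong>\<^sub>g H"
  then obtain h where h: "pre_digraph.digraph_isomorphism (with_proj G) h"
    and H: "with_proj H = app_iso h (with_proj G)"
    unfolding digraph_iso_def by blast
  let ?f = "iso_verts h"
  have parts: "pverts H = ?f ` pverts G" "parcs H = iso_arcs h ` parcs G" "fst = iso_tail h" "snd = iso_head h"
    using arg_cong[OF H, of verts] arg_cong[OF H, of arcs] arg_cong[OF H, of tail] arg_cong[OF H, of head]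
    by simp_all
  have inj: "inj_on ?f (pverts G)"
    and arc: "\<And>a. a \<in> parcs G \<Longrightarrow> iso_arcs h a = (?f (fst a), ?f (snd a))"
    using h unfolding pre_digraph.digraph_isomorphism_def by (auto simp: prod_eq_iff simp flip: parts(3,4))
  have "?iso ?f"
  proof (intro conjI ballI)
    show "bij_betw ?f (pverts G) (pverts H)" using inj parts(1) by (simp add: bij_betw_def)
    fix u v assume uv: "u \<in> pverts G" "v \<in> pverts G"
    show "(u, v) \<in> parcs G \<longleftrightarrow> (?f u, ?f v) \<in> parcs H"
    proof
      assume "(u, v) \<in> parcs G"
      then show "(?f u, ?f v) \<in> parcs H" using arc[of "(u, v)"] parts(2) by force
    next
      assume "(?f u, ?f v) \<in> parcs H"
      then obtain x y where xy: "(x, y) \<in> parcs G" "?f u = ?f x" "?f v = ?f y"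
        using arc parts(2) by force
      then show "(u, v) \<in> parcs G"
        using inj uv G.in_arcsD1[OF xy(1)] G.in_arcsD2[OF xy(1)] by (auto dest: inj_onD)
    qed
  qed
  then show "\<exists>f. ?iso f" by blast
next
  interpret G: pair_wf_digraph G by fact
  interpret H: pair_wf_digraph H by fact
  assume "\<exists>f. ?iso f"
  then obtain f where bij: "bij_betw f (pverts G) (pverts H)"
    and arcs: "\<And>u v. u \<in> pverts G \<Longrightarrow> v \<in> pverts G \<Longrightarrow> (u, v) \<in> parcs G \<longleftrightarrow> (f u, f v) \<in> parcs H" by blast
  define h where "h = \<lparr>iso_verts = f, iso_arcs = map_prod f f, iso_head = snd, iso_tail = fst\<rparr>"
  have inj: "inj_on f (pverts G)" using bij by (simp add: bij_betw_def)
  have "parcs G \<subseteq> pverts G \<times> pverts G" using G.in_arcsD1 G.in_arcsD2 by auto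
  then have "inj_on (map_prod f f) (parcs G)"
    using map_prod_inj_on[OF inj inj] inj_on_subset by blast
  then have "pre_digraph.digraph_isomorphism (with_proj G) h"
    using inj G.wf_digraph_axioms by (auto simp: pre_digraph.digraph_isomorphism_def h_def)
  moreover have "parcs H = map_prod f f ` parcs G"
  proof (intro equalityI subsetI)
    fix e assume e: "e \<in> parcs H"
    then have "fst e \<in> f ` pverts G" "snd e \<in> f ` pverts G"
      using bij H.arc_fst_in_verts H.arc_snd_in_verts by (auto simp: bij_betw_def)
    then obtain u v where "u \<in> pverts G" "v \<in> pverts G" "e = (f u, f v)"
      by (metis imageE prod.collapse)
    with e arcs show "e \<in> map_prod f f ` parcs G" by force
  next
    fix e assume "e \<in> map_prod f f ` parcs G"
    then obtain u v where "(u, v) \<in> parcs G" "e = (f u, f v)" by auto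
    then show "e \<in> parcs H" using arcs[of u v] G.in_arcsD1 G.in_arcsD2 by blast
  qed
  then have "with_proj H = app_iso h (with_proj G)"
    using bij by (simp add: with_proj_def app_iso_def h_def bij_betw_def)
  ultimately show "G \<cong>\<^sub>g H" unfolding digraph_iso_def by blast
qed

lemma clique_cone_bij:
  assumes "clique_cone H ns" and bij: "bij_betw f (pverts G) (pverts H)"
    and arcs: "\<And>u v. u \<in> pverts G \<Longrightarrow> v \<in> pverts G \<Longrightarrow> (u, v) \<in> parcs G \<longleftrightarrow> (f u, f v) \<in> parcs H"
  shows "clique_cone G ns"
proof -
  obtain c k where c: "c \<in> pverts H" and k: "\<forall>u\<in>pverts H - {c}. k u < length ns"
    and card: "\<forall>i<length ns. card {u \<in> pverts H - {c}. k u = i} = ns ! i"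
    and arcsH: "\<forall>u\<in>pverts H. \<forall>v\<in>pverts H. (u, v) \<in> parcs H \<longleftrightarrow> u \<noteq> v \<and> (u = c \<or> v = c \<or> k u = k v)"
    using assms(1) unfolding clique_cone_def by blast
  have "c \<in> f ` pverts G" using c bij by (simp add: bij_betw_def)
  then obtain b where b: "b \<in> pverts G" "f b = c" by blast
  have inj: "f u = f v \<longleftrightarrow> u = v" if "u \<in> pverts G" "v \<in> pverts G" for u v
    using bij that by (auto simp: bij_betw_def inj_on_eq_iff)
  have fV: "f u \<in> pverts H" if "u \<in> pverts G" for u using bij that by (auto simp: bij_betw_def)
  show ?thesis
    unfolding clique_cone_def
  proof (intro exI[of _ b] exI[of _ "\<lambda>u. k (f u)"] conjI ballI allI impI)
    fix i assume i: "i < length ns"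
    have "f ` {u \<in> pverts G - {b}. k (f u) = i} = {u \<in> pverts H - {c}. k u = i}"
      using bij b inj by (auto simp: bij_betw_def)
    moreover have "inj_on f {u \<in> pverts G - {b}. k (f u) = i}"
      using inj by (auto intro: inj_onI)
    ultimately show "card {u \<in> pverts G - {b}. k (f u) = i} = ns ! i"
      using card i by (metis (no_types, lifting) card_image)
  next
    fix u v assume "u \<in> pverts G" "v \<in> pverts G"
    then show "(u, v) \<in> parcs G \<longleftrightarrow> u \<noteq> v \<and> (u = b \<or> v = b \<or> k (f u) = k (f v))"
      using arcs arcsH fV inj b by auto
  qed (use b k fV inj in auto)
qed

text \<open>The apex is sent to the apex, and the \<open>i\<close>-th clique to the
  \<open>i\<close>-th clique by any bijection between these sets of equal size.\<close>

lemma clique_cone_unique: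
  assumes "clique_cone G ns" "clique_cone H ns" and fin: "finite (pverts G)" "finite (pverts H)"
  obtains f where "bij_betw f (pverts G) (pverts H)"
    "\<And>u v. u \<in> pverts G \<Longrightarrow> v \<in> pverts G \<Longrightarrow> (u, v) \<in> parcs G \<longleftrightarrow> (f u, f v) \<in> parcs H"
proof -
  obtain c k where c: "c \<in> pverts G" and k: "\<forall>u\<in>pverts G - {c}. k u < length ns"
    and card: "\<forall>i<length ns. card {u \<in> pverts G - {c}. k u = i} = ns ! i"
    and arcs: "\<forall>u\<in>pverts G. \<forall>v\<in>pverts G. (u, v) \<in> parcs G \<longleftrightarrow> u \<noteq> v \<and> (u = c \<or> v = c \<or> k u = k v)"
    using assms(1) unfolding clique_cone_def by blast
  obtain c' k' where c': "c' \<in> pverts H" and k': "\<forall>u\<in>pverts H - {c'}. k' u < length ns"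
    and card': "\<forall>i<length ns. card {u \<in> pverts H - {c'}. k' u = i} = ns ! i"
    and arcs': "\<forall>u\<in>pverts H. \<forall>v\<in>pverts H. (u, v) \<in> parcs H \<longleftrightarrow> u \<noteq> v \<and> (u = c' \<or> v = c' \<or> k' u = k' v)"
    using assms(2) unfolding clique_cone_def by blast
  let ?A = "\<lambda>i. {u \<in> pverts G - {c}. k u = i}" and ?B = "\<lambda>i. {u \<in> pverts H - {c'}. k' u = i}"
  have "\<forall>i\<in>{..<length ns}. \<exists>h. bij_betw h (?A i) (?B i)"
    using card card' fin by (intro ballI finite_same_card_bij) auto
  from bchoice[OF this] obtain h where h: "\<And>i. i < length ns \<Longrightarrow> bij_betw (h i) (?A i) (?B i)"
    by auto
  define f where "f u = (if u = c then c' else h (k u) u)" for u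
  have f: "f u \<in> pverts H - {c'}" "k' (f u) = k u" if "u \<in> pverts G - {c}" for u
    using bij_betwE[OF h[of "k u"]] that k by (auto simp: f_def)
  have fc: "f c = c'" by (simp add: f_def)
  have f_eq: "f x = c' \<longleftrightarrow> x = c" if "x \<in> pverts G" for x
    using f(1)[of x] that fc by auto
  have inj: "inj_on f (pverts G)"
  proof (rule inj_onI)
    fix u v assume uv: "u \<in> pverts G" "v \<in> pverts G" "f u = f v"
    show "u = v"
    proof (cases "u = c \<or> v = c")
      case True
      then show ?thesis using uv f_eq[of u] f_eq[of v] by metis
    next
      case False
      then have "k u = k v" using uv f(2)[of u] f(2)[of v] by auto
      moreover have "inj_on (h (k u)) (?A (k u))" using h k uv False by (auto simp: bij_betw_def)
      ultimately show ?thesis using uv False by (auto simp: f_def dest: inj_onD)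
    qed
  qed
  have "f ` pverts G = pverts H"
  proof (intro equalityI subsetI)
    fix w assume w: "w \<in> pverts H"
    show "w \<in> f ` pverts G"
    proof (cases "w = c'")
      case True
      then show ?thesis using c fc by force
    next
      case False
      then have "w \<in> ?B (k' w)" using w by auto
      moreover have "h (k' w) ` ?A (k' w) = ?B (k' w)" using h k' w False by (auto simp: bij_betw_def)
      ultimately obtain u where "u \<in> ?A (k' w)" "w = h (k' w) u" by blast
      then have "w = f u" "u \<in> pverts G" by (auto simp: f_def)
      then show ?thesis by blast
    qed
  qed (use f fc c' in auto)
  with inj have bij: "bij_betw f (pverts G) (pverts H)" by (simp add: bij_betw_def)
  moreover have "(u, v) \<in> parcs G \<longleftrightarrow> (f u, f v) \<in> parcs H" if uv: "u \<in> pverts G" "v \<in> pverts G" for u v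
  proof -
    have "f u = f v \<longleftrightarrow> u = v" using inj uv by (simp add: inj_on_eq_iff)
    moreover have "f u = c' \<longleftrightarrow> u = c" "f v = c' \<longleftrightarrow> v = c" using f_eq uv by auto
    moreover have "f u \<in> pverts H" "f v \<in> pverts H" using bij uv by (auto dest: bij_betwE)
    ultimately have "(f u, f v) \<in> parcs H \<longleftrightarrow> u \<noteq> v \<and> (u = c \<or> v = c \<or> k' (f u) = k' (f v))"
      using arcs' by simp
    also have "\<dots> \<longleftrightarrow> u \<noteq> v \<and> (u = c \<or> v = c \<or> k u = k v)"
      using f(2)[of u] f(2)[of v] uv by (cases "u = c"; cases "v = c") auto
    finally show ?thesis using uv arcs by simp
  qed
  ultimately show thesis using that by blast
qed

text \<open>Turns isomorphism with a named graph into a condition on \<open>G\<close> that mentions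
  only the list of clique orders.\<close>

lemma graph_iso_iff_clique_cone:
  assumes "pair_fin_digraph G" "pair_fin_digraph H" "clique_cone H ns"
  shows "G \<cong>\<^sub>g H \<longleftrightarrow> clique_cone G ns"
proof -
  interpret G: pair_fin_digraph G by fact
  interpret H: pair_fin_digraph H by fact
  note iso = graph_iso_iff_bij[OF G.pair_wf_digraph_axioms H.pair_wf_digraph_axioms]
  show ?thesis
  proof
    assume "G \<cong>\<^sub>g H"
    then show "clique_cone G ns"
      unfolding iso using clique_cone_bij[OF assms(3)] by blast
  next
    assume "clique_cone G ns"
    then obtain f where "bij_betw f (pverts G) (pverts H)"
      "\<And>u v. u \<in> pverts G \<Longrightarrow> v \<in> pverts G \<Longrightarrow> (u, v) \<in> parcs G \<longleftrightarrow> (f u, f v) \<in> parcs H"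
      using clique_cone_unique[OF _ assms(3) G.pair_finite_verts H.pair_finite_verts] by blast
    then show "G \<cong>\<^sub>g H" unfolding iso by blast
  qed
qed

text \<open>Permuting the labels permutes the list; this allows the clique orders to be
  sorted.\<close>

lemma clique_cone_mset_cong:
  assumes "clique_cone G ns" "mset ns = mset ms"
  shows "clique_cone G ms"
proof -
  obtain p where p: "p permutes {..<length ms}" "permute_list p ms = ns"
    using mset_eq_permutation[OF assms(2)] by blast
  have len: "length ns = length ms" using p by auto
  obtain c k where c: "c \<in> pverts G" and k: "\<forall>u\<in>pverts G - {c}. k u < length ns"
    and card: "\<forall>i<length ns. card {u \<in> pverts G - {c}. k u = i} = ns ! i"
    and arcs: "\<forall>u\<in>pverts G. \<forall>v\<in>pverts G. (u, v) \<in> parcs G \<longleftrightarrow> u \<noteq> v \<and> (u = c \<or> v = c \<or> k u = k v)"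
    using assms(1) unfolding clique_cone_def by blast
  show ?thesis
    unfolding clique_cone_def
  proof (intro exI[of _ c] exI[of _ "\<lambda>u. p (k u)"] conjI ballI allI impI)
    show "p (k u) < length ms" if "u \<in> pverts G - {c}" for u
      using that k len permutes_in_image[OF p(1), of "k u"] by auto
    fix j assume j: "j < length ms"
    obtain i where i: "p i = j" using permutes_surj[OF p(1)] by (metis surjD)
    then have "i < length ms" using permutes_in_image[OF p(1), of i] j by auto
    have "{u \<in> pverts G - {c}. p (k u) = j} = {u \<in> pverts G - {c}. k u = i}"
      using i permutes_inj[OF p(1)] by (auto dest: injD)
    then show "card {u \<in> pverts G - {c}. p (k u) = j} = ms ! j"
      using card i p len permute_list_nth[OF p(1) \<open>i < length ms\<close>] \<open>i < length ms\<close> by auto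
  qed (use c arcs permutes_inj[OF p(1)] in \<open>auto dest: injD\<close>)
qed

section \<open>Clique structure of disjoint unions and joins\<close>

definition clique_union :: "'a pair_pre_digraph \<Rightarrow> nat list \<Rightarrow> bool" where
  "clique_union G ns \<longleftrightarrow> (\<exists>k.
     (\<forall>u\<in>pverts G. k u < length ns) \<and>
     (\<forall>i<length ns. card {u \<in> pverts G. k u = i} = ns ! i) \<and>
     (\<forall>u\<in>pverts G. \<forall>v\<in>pverts G. (u, v) \<in> parcs G \<longleftrightarrow> u \<noteq> v \<and> k u = k v))"

lemma pair_fin_digraph_complete_graph: "pair_fin_digraph (complete_graph n)"
proof unfold_locales
  show "finite (parcs (complete_graph n))"
    by (rule finite_subset[of _ "{..<n} \<times> {..<n}"]) (auto simp: complete_graph_def)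
qed (auto simp: complete_graph_def)

lemma pair_fin_digraph_disjoint_union:
  assumes "pair_fin_digraph G" "pair_fin_digraph H"
  shows "pair_fin_digraph (G \<union>\<^sub>g H)"
proof -
  interpret G: pair_fin_digraph G by fact
  interpret H: pair_fin_digraph H by fact
  show ?thesis
    using G.pair_finite_verts G.pair_finite_arcs H.pair_finite_verts H.pair_finite_arcs
      G.in_arcsD1 G.in_arcsD2 H.in_arcsD1 H.in_arcsD2
    by unfold_locales (auto simp: disjoint_union_def)
qed

lemma pair_fin_digraph_join:
  assumes "pair_fin_digraph G" "pair_fin_digraph H"
  shows "pair_fin_digraph (G \<or>\<^sub>g H)"
proof -
  interpret G: pair_fin_digraph G by fact
  interpret H: pair_fin_digraph H by fact
  show ?thesis
    using G.pair_finite_verts G.pair_finite_arcs H.pair_finite_verts H.pair_finite_arcs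
      G.in_arcsD1 G.in_arcsD2 H.in_arcsD1 H.in_arcsD2
    by unfold_locales (auto simp: join_def disjoint_union_def)
qed

lemma clique_union_complete_graph: "clique_union (complete_graph n) [n]"
  unfolding clique_union_def
  by (rule exI[of _ "\<lambda>_. 0"]) (simp add: complete_graph_def)

lemma clique_union_disjoint_union:
  assumes "clique_union G ns" "clique_union H ms"
  shows "clique_union (G \<union>\<^sub>g H) (ns @ ms)"
proof -
  obtain k where k: "\<forall>u\<in>pverts G. k u < length ns"
    and card: "\<forall>i<length ns. card {u \<in> pverts G. k u = i} = ns ! i"
    and arcs: "\<forall>u\<in>pverts G. \<forall>v\<in>pverts G. (u, v) \<in> parcs G \<longleftrightarrow> u \<noteq> v \<and> k u = k v"
    using assms(1) unfolding clique_union_def by blast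
  obtain l where l: "\<forall>u\<in>pverts H. l u < length ms"
    and cardH: "\<forall>i<length ms. card {u \<in> pverts H. l u = i} = ms ! i"
    and arcsH: "\<forall>u\<in>pverts H. \<forall>v\<in>pverts H. (u, v) \<in> parcs H \<longleftrightarrow> u \<noteq> v \<and> l u = l v"
    using assms(2) unfolding clique_union_def by blast
  \<comment> \<open>Labels of the second graph are shifted past those of the first, matching the
    concatenation of the lists.\<close>
  define h where "h = case_sum k (\<lambda>u. length ns + l u)"
  show ?thesis
    unfolding clique_union_def
  proof (rule exI[of _ h], intro conjI allI impI ballI)
    fix i assume i: "i < length (ns @ ms)"
    show "card {u \<in> pverts (G \<union>\<^sub>g H). h u = i} = (ns @ ms) ! i"
    proof (cases "i < length ns")
      case True
      then have "{u \<in> pverts (G \<union>\<^sub>g H). h u = i} = Inl ` {u \<in> pverts G. k u = i}"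
        by (auto simp: disjoint_union_def h_def)
      then show ?thesis using True card by (simp add: card_image nth_append)
    next
      case False
      then have "{u \<in> pverts (G \<union>\<^sub>g H). h u = i} = Inr ` {u \<in> pverts H. l u = i - length ns}"
        using k by (auto simp: disjoint_union_def h_def)
      then show ?thesis using False i cardH by (simp add: card_image nth_append)
    qed
  next
    fix u v assume "u \<in> pverts (G \<union>\<^sub>g H)" "v \<in> pverts (G \<union>\<^sub>g H)"
    then show "(u, v) \<in> parcs (G \<union>\<^sub>g H) \<longleftrightarrow> u \<noteq> v \<and> h u = h v"
      using arcs arcsH k by (force simp: disjoint_union_def h_def)
  qed (use k l in \<open>auto simp: disjoint_union_def h_def trans_less_add1\<close>)
qed

lemma clique_cone_join:
  assumes "clique_union H ns"
  shows "clique_cone (complete_graph 1 \<or>\<^sub>g H) ns"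
proof -
  obtain k where k: "\<forall>u\<in>pverts H. k u < length ns"
    and card: "\<forall>i<length ns. card {u \<in> pverts H. k u = i} = ns ! i"
    and arcs: "\<forall>u\<in>pverts H. \<forall>v\<in>pverts H. (u, v) \<in> parcs H \<longleftrightarrow> u \<noteq> v \<and> k u = k v"
    using assms unfolding clique_union_def by blast
  let ?J = "complete_graph 1 \<or>\<^sub>g H"
  have V: "pverts ?J = insert (Inl 0) (Inr ` pverts H)"
    by (auto simp: join_def disjoint_union_def complete_graph_def)
  have E: "parcs ?J = map_prod Inr Inr ` parcs H \<union> {Inl 0} \<times> Inr ` pverts H \<union> Inr ` pverts H \<times> {Inl 0}"
    by (auto simp: join_def disjoint_union_def complete_graph_def)
  define h where "h = case_sum (\<lambda>_::nat. 0) k"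
  show ?thesis
    unfolding clique_cone_def
  proof (rule exI[of _ "Inl (0::nat)"], rule exI[of _ h], intro conjI allI impI ballI)
    fix i assume i: "i < length ns"
    have "{u \<in> pverts ?J - {Inl 0}. h u = i} = Inr ` {u \<in> pverts H. k u = i}"
      unfolding V by (auto simp: h_def)
    then show "card {u \<in> pverts ?J - {Inl 0}. h u = i} = ns ! i"
      using i card by (simp add: card_image)
  next
    fix u v assume "u \<in> pverts ?J" "v \<in> pverts ?J"
    then show "(u, v) \<in> parcs ?J \<longleftrightarrow> u \<noteq> v \<and> (u = Inl 0 \<or> v = Inl 0 \<or> h u = h v)"
      using arcs unfolding V E by (force simp: h_def)
  next
    fix u assume "u \<in> pverts ?J - {Inl 0}"
    then show "h u < length ns" using k unfolding V by (auto simp: h_def)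
  next
    show "Inl 0 \<in> pverts ?J" unfolding V by simp
  qed
qed

text \<open>A complete graph is a cone over a single clique with one vertex less; the vertex 0 is
  taken as the apex.\<close>

lemma clique_cone_complete_graph: "clique_cone (complete_graph (Suc n)) [n]"
proof -
  have "{u. u < Suc n \<and> u \<noteq> 0} = {1..n}" by auto
  then show ?thesis
    unfolding clique_cone_def
    by (intro exI[of _ 0] exI[of _ "\<lambda>_. 0"]) (simp add: complete_graph_def)
qed

subsection \<open>The numerical condition\<close>

text \<open>\<open>deficit n = 1 - n / (n + (1 - 0.5858))\<close>\<close>

definition deficit :: "nat \<Rightarrow> real" where
  "deficit n = 2071 / (5000 * real n + 2071)"

lemma deficit_pos: "deficit n > 0"
  by (simp add: deficit_def add_nonneg_pos)

lemma deficit_antimono: "m \<le> n \<Longrightarrow> deficit n \<le> deficit m"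
  by (simp add: deficit_def frac_le)

text \<open>Each summand equals \<open>1 - deficit n\<close>, so the upper bound on the sum becomes
  a lower bound on the total deficit, depending on the number of cliques. For four cliques it is
  \<open>4 - 2929 / 858 = 503 / 858\<close>.\<close>

lemma cone_sum_less_iff:
  "(\<Sum>n\<leftarrow>ns. real n / (real n + (1 - 0.5858))) < 0.5858 / (2 * 0.5858 - 1) \<longleftrightarrow>
    real (length ns) - 2929 / 858 < sum_list (map deficit ns)"
proof -
  have "real n / (real n + (1 - 0.5858)) = 1 - deficit n" for n
  proof -
    have "real n / (real n + (1 - 0.5858)) = 5000 * real n / (5000 * real n + 2071)"
      by (simp add: field_simps)
    also have "\<dots> = 1 - deficit n"
      by (simp add: deficit_def add_nonneg_pos field_simps)
    finally show ?thesis .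
  qed
  then have "(\<Sum>n\<leftarrow>ns. real n / (real n + (1 - 0.5858))) = real (length ns) - sum_list (map deficit ns)"
    by (induction ns) (simp_all)
  moreover have "0.5858 / (2 * 0.5858 - 1) = (2929 / 858 :: real)" by simp
  ultimately show ?thesis by (simp only:) linarith
qed

text \<open>The lower bound admits up to three cliques unconditionally; the upper bound, with
  \<open>deficit 1 = 2071 / 7071\<close>, excludes five or more.\<close>

lemma sum_list_deficit_bounds:
  assumes "\<forall>n\<in>set ns. n \<ge> 1"
  shows "0 \<le> sum_list (map deficit ns)" "sum_list (map deficit ns) \<le> real (length ns) * (2071 / 7071)"
proof -
  show "0 \<le> sum_list (map deficit ns)"
    by (rule sum_list_nonneg) (auto simp: less_imp_le deficit_pos)
  have "deficit n \<le> 2071 / 7071" if "n \<ge> 1" for n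
    using deficit_antimono[OF that] by (simp add: deficit_def)
  with assms show "sum_list (map deficit ns) \<le> real (length ns) * (2071 / 7071)"
    by (induction ns) (auto simp: algebra_simps add_mono)
qed

text \<open>Multiplying the deficit inequality by its two positive denominators \<open>x\<close> and
  \<open>y\<close> gives, up to a positive factor, the value of the polynomial.\<close>

lemma r_poly_less_0_iff:
  "r_poly n\<^sub>3 n\<^sub>4 (- 0.5858) < 0 \<longleftrightarrow>
    503 / 858 < deficit 1 + deficit 1 + deficit n\<^sub>3 + deficit n\<^sub>4"
proof -
  define x y where "x = 5000 * real n\<^sub>3 + 2071" and "y = 5000 * real n\<^sub>4 + 2071"
  have pos: "x > 0" "y > 0" by (simp_all add: x_def y_def add_nonneg_pos)
  have n: "real n\<^sub>3 = (x - 2071) / 5000" "real n\<^sub>4 = (y - 2071) / 5000"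
    by (simp_all add: x_def y_def)
  \<comment> \<open>The factor in front is positive (\<open>3033459\<close> is
    \<open>429 * 7071\<close>), so the bracket decides the sign.\<close>
  have "r_poly n\<^sub>3 n\<^sub>4 (- 0.5858) =
     3033459 / 12500000 / 25000000 * (503 / 858 * x * y - 4142 / 7071 * x * y - 2071 * y - 2071 * x)"
    unfolding r_poly_def of_nat_add of_nat_mult of_nat_numeral of_nat_1 n
    by (simp add: field_simps power2_eq_square power3_eq_cube power4_eq_xxxx)
  then have "r_poly n\<^sub>3 n\<^sub>4 (- 0.5858) < 0 \<longleftrightarrow>
      503 / 858 * x * y < 4142 / 7071 * x * y + 2071 * y + 2071 * x"
    by (simp only: mult_less_0_iff) auto
  also have "\<dots> \<longleftrightarrow> 503 / 858 < 4142 / 7071 + 2071 / x + 2071 / y"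
    using pos by (simp add: field_simps) linarith
  also have "\<dots> \<longleftrightarrow> 503 / 858 < deficit 1 + deficit 1 + deficit n\<^sub>3 + deficit n\<^sub>4"
    by (simp add: deficit_def x_def y_def)
  finally show ?thesis .
qed

text \<open>\<open>deficit\<close> decreases, so for fixed first three orders the condition is a
  threshold on \<open>n\<^sub>4\<close>; it suffices to compare at the last admissible and the first
  excluded value. Each open-ended family is excluded by its smallest member.\<close>

lemma deficit_sum_four_iff:
  assumes "1 \<le> n\<^sub>1" "n\<^sub>1 \<le> n\<^sub>2" "n\<^sub>2 \<le> n\<^sub>3" "n\<^sub>3 \<le> n\<^sub>4"
  shows "503 / 858 < deficit n\<^sub>1 + deficit n\<^sub>2 + deficit n\<^sub>3 + deficit n\<^sub>4 \<longleftrightarrow>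
      ((n\<^sub>1 = 1 \<and> n\<^sub>2 = 1 \<and> 1 \<le> n\<^sub>3 \<and> n\<^sub>3 \<le> 873) \<or>
        (n\<^sub>1 = 1 \<and> n\<^sub>2 = 1 \<and> n\<^sub>3 \<ge> 874 \<and> r_poly n\<^sub>3 n\<^sub>4 (- 0.5858) < 0) \<or>
        (n\<^sub>1 = 1 \<and> n\<^sub>2 = 2 \<and>
          (n\<^sub>3 = 2 \<or>
           (n\<^sub>3 = 3 \<and> 3 \<le> n\<^sub>4 \<and> n\<^sub>4 \<le> 870) \<or>
           (n\<^sub>3 = 4 \<and> 4 \<le> n\<^sub>4 \<and> n\<^sub>4 \<le> 14) \<or>
           (n\<^sub>3 = 5 \<and> 5 \<le> n\<^sub>4 \<and> n\<^sub>4 \<le> 8) \<or>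
           (n\<^sub>3 = 6 \<and> n\<^sub>4 = 6))) \<or>
        (n\<^sub>1 = 1 \<and> n\<^sub>2 = 3 \<and>
          ((n\<^sub>3 = 3 \<and> 3 \<le> n\<^sub>4 \<and> n\<^sub>4 \<le> 7) \<or> (n\<^sub>3 = 4 \<and> n\<^sub>4 = 4))) \<or>
        (n\<^sub>1 = 2 \<and> n\<^sub>2 = 2 \<and> n\<^sub>3 = 2 \<and> 2 \<le> n\<^sub>4 \<and> n\<^sub>4 \<le> 5))"
    (is "?sum \<longleftrightarrow> ?table")
proof -
  have val: "deficit 1 = 2071 / 7071" "deficit 2 = 2071 / 12071" "deficit 3 = 2071 / 17071"
    "deficit 4 = 2071 / 22071" "deficit 5 = 2071 / 27071" "deficit 6 = 2071 / 32071"
    "deficit 7 = 2071 / 37071" "deficit 8 = 2071 / 42071" "deficit 9 = 2071 / 47071"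
    "deficit 14 = 2071 / 72071" "deficit 15 = 2071 / 77071" "deficit 870 = 2071 / 4352071"
    "deficit 871 = 2071 / 4357071" "deficit 873 = 2071 / 4367071"
    by (simp_all add: deficit_def)
  note anti = deficit_antimono
  show ?thesis
  proof (cases "n\<^sub>1 = 1")
    case n1: True
    consider "n\<^sub>2 = 1" | "n\<^sub>2 = 2" | "n\<^sub>2 = 3" | "n\<^sub>2 \<ge> 4" using assms by linarith
    then show ?thesis
    proof cases
      case n2: 1
      \<comment> \<open>\<open>deficit 873\<close> alone exceeds
        \<open>503 / 858 - 2 * deficit 1\<close>, so \<open>n\<^sub>4\<close> is unrestricted.
        Larger \<open>n\<^sub>3\<close> are left to \<open>r_poly\<close>.\<close>
      have ?sum if "n\<^sub>3 \<le> 873"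
        using anti[OF that] deficit_pos[of n\<^sub>4] by (simp add: n1 n2 val[unfolded One_nat_def])
      then show ?thesis
        using assms(2,3) r_poly_less_0_iff[of n\<^sub>3 n\<^sub>4] by (auto simp: n1 n2 not_le)
    next
      case n2: 2
      \<comment> \<open>For \<open>n\<^sub>3 = 2\<close> the first three deficits suffice; from 3 to
        6 they leave a threshold for \<open>n\<^sub>4\<close>; the orders 1, 2, 7, 7 already
        fail.\<close>
      consider "n\<^sub>3 = 2" | "n\<^sub>3 = 3" | "n\<^sub>3 = 4" | "n\<^sub>3 = 5" | "n\<^sub>3 = 6" | "n\<^sub>3 \<ge> 7"
        using assms n2 by linarith
      then show ?thesis
      proof cases
        case 1
        then show ?thesis using deficit_pos[of n\<^sub>4] by (simp add: n1 n2 val[unfolded One_nat_def])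
      next
        case 2
        then show ?thesis
          using assms(4) anti[of n\<^sub>4 870] anti[of 871 n\<^sub>4]
          by (cases "n\<^sub>4 \<le> 870") (auto simp: n1 n2 val[unfolded One_nat_def])
      next
        case 3
        then show ?thesis
          using assms(4) anti[of n\<^sub>4 14] anti[of 15 n\<^sub>4]
          by (cases "n\<^sub>4 \<le> 14") (auto simp: n1 n2 val[unfolded One_nat_def])
      next
        case 4
        then show ?thesis
          using assms(4) anti[of n\<^sub>4 8] anti[of 9 n\<^sub>4]
          by (cases "n\<^sub>4 \<le> 8") (auto simp: n1 n2 val[unfolded One_nat_def])
      next
        case 5
        then show ?thesis
          using assms(4) anti[of n\<^sub>4 6] anti[of 7 n\<^sub>4]
          by (cases "n\<^sub>4 \<le> 6") (auto simp: n1 n2 val[unfolded One_nat_def])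
      next
        case 6
        then show ?thesis
          using assms(4) anti[of 7 n\<^sub>3] anti[of 7 n\<^sub>4]
          by (auto simp: n1 n2 val[unfolded One_nat_def])
      qed
    next
      case n2: 3
      consider "n\<^sub>3 = 3" | "n\<^sub>3 = 4" | "n\<^sub>3 \<ge> 5" using assms n2 by linarith
      then show ?thesis
      proof cases
        case 1
        then show ?thesis
          using assms(4) anti[of n\<^sub>4 7] anti[of 8 n\<^sub>4]
          by (cases "n\<^sub>4 \<le> 7") (auto simp: n1 n2 val[unfolded One_nat_def])
      next
        case 2
        then show ?thesis
          using assms(4) anti[of n\<^sub>4 4] anti[of 5 n\<^sub>4]
          by (cases "n\<^sub>4 \<le> 4") (auto simp: n1 n2 val[unfolded One_nat_def])
      next
        case 3
        then show ?thesis
          using assms(4) anti[of 5 n\<^sub>3] anti[of 5 n\<^sub>4]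
          by (auto simp: n1 n2 val[unfolded One_nat_def])
      qed
    next
      \<comment> \<open>The orders 1, 4, 4, 4 already fail.\<close>
      case 4
      then show ?thesis
        using assms(3,4) anti[of 4 n\<^sub>2] anti[of 4 n\<^sub>3] anti[of 4 n\<^sub>4]
        by (auto simp: n1 val[unfolded One_nat_def])
    qed
  next
    case n1: False
    \<comment> \<open>Beyond 2, 2, 2 the extremal orders are 2, 2, 3, 3, then 2, 3, 3, 3 and 3, 3,
      3, 3, and all of them fail.\<close>
    consider "n\<^sub>1 = 2" "n\<^sub>2 = 2" "n\<^sub>3 = 2" | "n\<^sub>1 = 2" "n\<^sub>2 = 2" "n\<^sub>3 \<ge> 3" | "n\<^sub>1 = 2" "n\<^sub>2 \<ge> 3" | "n\<^sub>1 \<ge> 3"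
      using assms n1 by linarith
    then show ?thesis
    proof cases
      case 1
      then show ?thesis
        using assms(4) anti[of n\<^sub>4 5] anti[of 6 n\<^sub>4]
        by (cases "n\<^sub>4 \<le> 5") (auto simp: val)
    next
      case 2
      then show ?thesis
        using assms(4) anti[of 3 n\<^sub>3] anti[of 3 n\<^sub>4] by (auto simp: val)
    next
      case 3
      then show ?thesis
        using assms(3,4) anti[of 3 n\<^sub>2] anti[of 3 n\<^sub>3] anti[of 3 n\<^sub>4] by (auto simp: val)
    next
      case 4
      then show ?thesis
        using assms(2-4) anti[of 3 n\<^sub>1] anti[of 3 n\<^sub>2] anti[of 3 n\<^sub>3] anti[of 3 n\<^sub>4] by (auto simp: val)
    qed
  qed
qed

section \<open>Assembling the classification\<close>

lemma (in pair_graph) distance_eigenvalue_2_less_iff: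
  assumes "card (pverts G) \<ge> 2" "distinct vs" "set vs = pverts G"
  shows "distance_eigenvalue G vs 2 < - a \<longleftrightarrow> \<not> nonneg_plane (pverts G) dist_form a"
proof -
  have "length vs \<ge> 2" using assms by (metis distinct_card)
  from second_eigenvalue_less_iff[OF assms(2) this, of dist_form a] show ?thesis
    by (simp add: assms(3) distance_eigenvalue_def distance_eigenvalues_def distance_matrix_def
        graph_dist_commute)
qed

theorem theorem1:
  fixes G :: "'a pair_pre_digraph" and vs :: "'a list"
  assumes "pair_graph G"
    and "Digraph_Component.connected (with_proj G)"
    and "card (pverts G) \<ge> 2"
    and "distinct vs" and "set vs = pverts G"
  shows "distance_eigenvalue G vs 2 \<in> {..< - 0.5858} \<longleftrightarrow>
    (\<exists>n\<ge>2. G \<cong>\<^sub>g complete_graph n) \<or>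
    (\<exists>n\<^sub>1\<ge>1. \<exists>n\<^sub>2\<ge>1.
       G \<cong>\<^sub>g complete_graph 1 \<or>\<^sub>g (complete_graph n\<^sub>1 \<union>\<^sub>g complete_graph n\<^sub>2)) \<or>
    (\<exists>n\<^sub>1\<ge>1. \<exists>n\<^sub>2\<ge>1. \<exists>n\<^sub>3\<ge>1.
       G \<cong>\<^sub>g complete_graph 1 \<or>\<^sub>g
         (complete_graph n\<^sub>1 \<union>\<^sub>g complete_graph n\<^sub>2 \<union>\<^sub>g complete_graph n\<^sub>3)) \<or>
    (\<exists>n\<^sub>1 n\<^sub>2 n\<^sub>3 n\<^sub>4. 1 \<le> n\<^sub>1 \<and> n\<^sub>1 \<le> n\<^sub>2 \<and> n\<^sub>2 \<le> n\<^sub>3 \<and> n\<^sub>3 \<le> n\<^sub>4 \<and>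
       G \<cong>\<^sub>g complete_graph 1 \<or>\<^sub>g
         (complete_graph n\<^sub>1 \<union>\<^sub>g complete_graph n\<^sub>2 \<union>\<^sub>g complete_graph n\<^sub>3 \<union>\<^sub>g complete_graph n\<^sub>4) \<and>
       ((n\<^sub>1 = 1 \<and> n\<^sub>2 = 1 \<and> 1 \<le> n\<^sub>3 \<and> n\<^sub>3 \<le> 873) \<or>
        (n\<^sub>1 = 1 \<and> n\<^sub>2 = 1 \<and> n\<^sub>3 \<ge> 874 \<and> r_poly n\<^sub>3 n\<^sub>4 (- 0.5858) < 0) \<or>
        (n\<^sub>1 = 1 \<and> n\<^sub>2 = 2 \<and>
          (n\<^sub>3 = 2 \<or>
           (n\<^sub>3 = 3 \<and> 3 \<le> n\<^sub>4 \<and> n\<^sub>4 \<le> 870) \<or>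
           (n\<^sub>3 = 4 \<and> 4 \<le> n\<^sub>4 \<and> n\<^sub>4 \<le> 14) \<or>
           (n\<^sub>3 = 5 \<and> 5 \<le> n\<^sub>4 \<and> n\<^sub>4 \<le> 8) \<or>
           (n\<^sub>3 = 6 \<and> n\<^sub>4 = 6))) \<or>
        (n\<^sub>1 = 1 \<and> n\<^sub>2 = 3 \<and>
          ((n\<^sub>3 = 3 \<and> 3 \<le> n\<^sub>4 \<and> n\<^sub>4 \<le> 7) \<or> (n\<^sub>3 = 4 \<and> n\<^sub>4 = 4))) \<or>
        (n\<^sub>1 = 2 \<and> n\<^sub>2 = 2 \<and> n\<^sub>3 = 2 \<and> 2 \<le> n\<^sub>4 \<and> n\<^sub>4 \<le> 5)))"
    (is "_ \<longleftrightarrow> ?K \<or> ?two \<or> ?three \<or>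
      (\<exists>n\<^sub>1 n\<^sub>2 n\<^sub>3 n\<^sub>4. 1 \<le> n\<^sub>1 \<and> n\<^sub>1 \<le> n\<^sub>2 \<and> n\<^sub>2 \<le> n\<^sub>3 \<and> n\<^sub>3 \<le> n\<^sub>4 \<and> ?J n\<^sub>1 n\<^sub>2 n\<^sub>3 n\<^sub>4 \<and> ?table n\<^sub>1 n\<^sub>2 n\<^sub>3 n\<^sub>4)")
proof -
  interpret pair_graph G by fact
  note fin = pair_fin_digraph_complete_graph pair_fin_digraph_disjoint_union pair_fin_digraph_join
  note cone = clique_cone_join clique_union_disjoint_union clique_union_complete_graph
  have iso1: "G \<cong>\<^sub>g complete_graph (Suc n) \<longleftrightarrow> clique_cone G [n]" for n
    by (intro graph_iso_iff_clique_cone pair_fin_digraph fin clique_cone_complete_graph)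
  have iso2: "G \<cong>\<^sub>g complete_graph 1 \<or>\<^sub>g (complete_graph n\<^sub>1 \<union>\<^sub>g complete_graph n\<^sub>2)
      \<longleftrightarrow> clique_cone G [n\<^sub>1, n\<^sub>2]" for n\<^sub>1 n\<^sub>2
    using cone(2)[OF cone(3) cone(3), of n\<^sub>1 n\<^sub>2]
    by (intro graph_iso_iff_clique_cone pair_fin_digraph fin clique_cone_join) simp
  have iso3: "G \<cong>\<^sub>g complete_graph 1 \<or>\<^sub>g
         (complete_graph n\<^sub>1 \<union>\<^sub>g complete_graph n\<^sub>2 \<union>\<^sub>g complete_graph n\<^sub>3)
      \<longleftrightarrow> clique_cone G [n\<^sub>1, n\<^sub>2, n\<^sub>3]" for n\<^sub>1 n\<^sub>2 n\<^sub>3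
    using cone(2)[OF cone(3) cone(2)[OF cone(3) cone(3)], of n\<^sub>1 n\<^sub>2 n\<^sub>3]
    by (intro graph_iso_iff_clique_cone pair_fin_digraph fin clique_cone_join) simp
  have iso4: "?J n\<^sub>1 n\<^sub>2 n\<^sub>3 n\<^sub>4 \<longleftrightarrow> clique_cone G [n\<^sub>1, n\<^sub>2, n\<^sub>3, n\<^sub>4]" for n\<^sub>1 n\<^sub>2 n\<^sub>3 n\<^sub>4
    using cone(2)[OF cone(3) cone(2)[OF cone(3) cone(2)[OF cone(3) cone(3)]], of n\<^sub>1 n\<^sub>2 n\<^sub>3 n\<^sub>4]
    by (intro graph_iso_iff_clique_cone pair_fin_digraph fin clique_cone_join) simp
  let ?less = "distance_eigenvalue G vs 2 < - 0.5858"
  have less_iff: "?less \<longleftrightarrow> real (length ns) - 2929 / 858 < sum_list (map deficit ns)"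
    if "clique_cone G ns" "ns \<noteq> []" "\<forall>n\<in>set ns. n \<ge> 1" for ns
  proof -
    have "nonneg_plane (pverts G) dist_form 0.5858 \<longleftrightarrow>
        0.5858 / (2 * 0.5858 - 1) \<le> (\<Sum>n\<leftarrow>ns. real n / (real n + (1 - 0.5858)))"
      by (rule nonneg_plane_iff_clique_cone[OF that]) simp_all
    then show ?thesis
      unfolding distance_eigenvalue_2_less_iff[OF assms(3-5)] not_le cone_sum_less_iff[symmetric]
      by linarith
  qed
  \<comment> \<open>With at most three cliques, \<open>length ns - 2929 / 858\<close> is negative
    while the total deficit is nonnegative.\<close>
  have short: ?less if "clique_cone G ns" "ns \<noteq> []" "\<forall>n\<in>set ns. n \<ge> 1" "length ns \<le> 3" for ns
    using less_iff[OF that(1-3)] sum_list_deficit_bounds(1)[OF that(3)] that(4) by simp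
  have four: "?less \<longleftrightarrow> ?table n\<^sub>1 n\<^sub>2 n\<^sub>3 n\<^sub>4"
    if "clique_cone G [n\<^sub>1, n\<^sub>2, n\<^sub>3, n\<^sub>4]" "1 \<le> n\<^sub>1" "n\<^sub>1 \<le> n\<^sub>2" "n\<^sub>2 \<le> n\<^sub>3" "n\<^sub>3 \<le> n\<^sub>4" for n\<^sub>1 n\<^sub>2 n\<^sub>3 n\<^sub>4
  proof -
    have "?less \<longleftrightarrow> 503 / 858 < deficit n\<^sub>1 + deficit n\<^sub>2 + deficit n\<^sub>3 + deficit n\<^sub>4"
      using less_iff[OF that(1)] that(2-5) by (simp add: add.assoc)
    also have "\<dots> \<longleftrightarrow> ?table n\<^sub>1 n\<^sub>2 n\<^sub>3 n\<^sub>4" by (rule deficit_sum_four_iff[OF that(2-5)])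
    finally show ?thesis .
  qed
  show ?thesis
    unfolding lessThan_iff
  proof
    assume less: ?less
    then have "\<not> nonneg_plane (pverts G) dist_form 0.5858"
      using distance_eigenvalue_2_less_iff[OF assms(3-5)] by simp
    then obtain ms where ms: "clique_cone G ms" "ms \<noteq> []" "\<forall>n\<in>set ms. n \<ge> 1"
      using clique_cone_if_no_nonneg_plane[OF assms(2,3)] by blast
    \<comment> \<open>Sorting provides the order of the clique sizes that the table
      presupposes.\<close>
    define ns where "ns = sort ms"
    have ns: "clique_cone G ns" "ns \<noteq> []" "\<forall>n\<in>set ns. n \<ge> 1" "sorted ns"
      using clique_cone_mset_cong[OF ms(1), of ns] ms(2,3)
      by (auto simp: ns_def simp flip: set_empty)
    \<comment> \<open>The bound on the deficits gives
      \<open>length ns * (5000 / 7071) < 2929 / 858\<close>, which fails from five cliques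
      on.\<close>
    have "real (length ns) < 5"
      using less less_iff[OF ns(1-3)] sum_list_deficit_bounds(2)[OF ns(3)] by simp
    then consider "length ns = 1" | "length ns = 2" | "length ns = 3" | "length ns = 4"
      using ns(2) by (cases "length ns") force+
    then show "?K \<or> ?two \<or> ?three \<or>
      (\<exists>n\<^sub>1 n\<^sub>2 n\<^sub>3 n\<^sub>4. 1 \<le> n\<^sub>1 \<and> n\<^sub>1 \<le> n\<^sub>2 \<and> n\<^sub>2 \<le> n\<^sub>3 \<and> n\<^sub>3 \<le> n\<^sub>4 \<and> ?J n\<^sub>1 n\<^sub>2 n\<^sub>3 n\<^sub>4 \<and> ?table n\<^sub>1 n\<^sub>2 n\<^sub>3 n\<^sub>4)"
    proof cases
      case 1
      then obtain n where "ns = [n]" by (auto simp: length_Suc_conv)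
      then have "Suc n \<ge> 2" "G \<cong>\<^sub>g complete_graph (Suc n)" using ns iso1 by auto
      then show ?thesis by blast
    next
      case 2
      then obtain n\<^sub>1 n\<^sub>2 where "ns = [n\<^sub>1, n\<^sub>2]" by (auto simp: length_Suc_conv numeral_eq_Suc)
      then have ?two using ns iso2 by auto
      then show ?thesis by blast
    next
      case 3
      then obtain n\<^sub>1 n\<^sub>2 n\<^sub>3 where "ns = [n\<^sub>1, n\<^sub>2, n\<^sub>3]" by (auto simp: length_Suc_conv numeral_eq_Suc)
      then have ?three using ns iso3 by auto
      then show ?thesis by blast
    next
      case 4
      then obtain n\<^sub>1 n\<^sub>2 n\<^sub>3 n\<^sub>4 where "ns = [n\<^sub>1, n\<^sub>2, n\<^sub>3, n\<^sub>4]"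
        by (auto simp: length_Suc_conv numeral_eq_Suc)
      then have *: "clique_cone G [n\<^sub>1, n\<^sub>2, n\<^sub>3, n\<^sub>4]" "1 \<le> n\<^sub>1" "n\<^sub>1 \<le> n\<^sub>2" "n\<^sub>2 \<le> n\<^sub>3" "n\<^sub>3 \<le> n\<^sub>4"
        using ns by auto
      have J: "?J n\<^sub>1 n\<^sub>2 n\<^sub>3 n\<^sub>4" by (rule iffD2[OF iso4 *(1)])
      have table: "?table n\<^sub>1 n\<^sub>2 n\<^sub>3 n\<^sub>4" by (rule iffD1[OF four[OF *] less])
      note ex = conjI[OF *(2) conjI[OF *(3) conjI[OF *(4) conjI[OF *(5) conjI[OF J table]]]]]
      show ?thesis
        by (intro disjI2, rule exI[of _ n\<^sub>1], rule exI[of _ n\<^sub>2], rule exI[of _ n\<^sub>3],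
            rule exI[of _ n\<^sub>4], rule ex)
    qed
  next
    assume "?K \<or> ?two \<or> ?three \<or>
      (\<exists>n\<^sub>1 n\<^sub>2 n\<^sub>3 n\<^sub>4. 1 \<le> n\<^sub>1 \<and> n\<^sub>1 \<le> n\<^sub>2 \<and> n\<^sub>2 \<le> n\<^sub>3 \<and> n\<^sub>3 \<le> n\<^sub>4 \<and> ?J n\<^sub>1 n\<^sub>2 n\<^sub>3 n\<^sub>4 \<and> ?table n\<^sub>1 n\<^sub>2 n\<^sub>3 n\<^sub>4)"
    then show ?less
    proof (elim disjE)
      assume ?K
      then obtain n where n: "n \<ge> 2" "G \<cong>\<^sub>g complete_graph n" by blast
      then obtain m where "n = Suc m" "m \<ge> 1" by (cases n) auto
      with n(2) iso1 short[of "[m]"] show ?thesis by simp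
    next
      assume ?two
      then obtain n\<^sub>1 n\<^sub>2 where "n\<^sub>1 \<ge> 1" "n\<^sub>2 \<ge> 1" "clique_cone G [n\<^sub>1, n\<^sub>2]" using iso2 by blast
      then show ?thesis using short[of "[n\<^sub>1, n\<^sub>2]"] by simp
    next
      assume ?three
      then obtain n\<^sub>1 n\<^sub>2 n\<^sub>3 where "n\<^sub>1 \<ge> 1" "n\<^sub>2 \<ge> 1" "n\<^sub>3 \<ge> 1" "clique_cone G [n\<^sub>1, n\<^sub>2, n\<^sub>3]"
        using iso3 by blast
      then show ?thesis using short[of "[n\<^sub>1, n\<^sub>2, n\<^sub>3]"] by simp
    next
      assume "\<exists>n\<^sub>1 n\<^sub>2 n\<^sub>3 n\<^sub>4. 1 \<le> n\<^sub>1 \<and> n\<^sub>1 \<le> n\<^sub>2 \<and> n\<^sub>2 \<le> n\<^sub>3 \<and> n\<^sub>3 \<le> n\<^sub>4 \<and> ?J n\<^sub>1 n\<^sub>2 n\<^sub>3 n\<^sub>4 \<and> ?table n\<^sub>1 n\<^sub>2 n\<^sub>3 n\<^sub>4"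
      then obtain n\<^sub>1 n\<^sub>2 n\<^sub>3 n\<^sub>4 where *: "1 \<le> n\<^sub>1" "n\<^sub>1 \<le> n\<^sub>2" "n\<^sub>2 \<le> n\<^sub>3" "n\<^sub>3 \<le> n\<^sub>4"
        and J: "?J n\<^sub>1 n\<^sub>2 n\<^sub>3 n\<^sub>4" and table: "?table n\<^sub>1 n\<^sub>2 n\<^sub>3 n\<^sub>4"
        by (elim exE conjE)
      show ?thesis by (rule iffD2[OF four[OF iffD1[OF iso4 J] *] table])
    qed
  qed
qed

end
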